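(* Let $p,q,r,s$ be real numbers and let $D_n$ be the $n\times n$ symmetric pentadiagonal matrix with perturbed corners determined by $p,q,r,s$. Let the numbers $\mu_j,\nu_j,\xi_j$ and the coefficients $\kappa_j$ (some of which depend on $n$) be those given in the context for the respective case. Then $$\det D_n=\begin{cases}\displaystyle\sum_{j=1}^5\kappa_j\,f(\mu_j)\,\mu_j^{\,n-5},& \text{if } q\ne0,\ s\ne0 \text{ and } n\ge6,\\[2mm] \displaystyle\sum_{j=1}^4\kappa_j\,f(\nu_j)\,\nu_j^{\,n-4},& \text{if } q=0,\ s\ne0 \text{ and } n\ge5,\\[2mm] \displaystyle\sum_{j=1}^2\kappa_j\,f(\xi_j)\,\xi_j^{\,n-2},& \text{if } q\ne0,\ s=0 \text{ and } n\ge3,\\[2mm] r^2p^{n-2},& \text{if } q=s=0 \text{ and } n\ge3,\end{cases}$$ where $f$ is the polynomial function $$f(z)=\begin{cases}(r-s)z^4+(ps-q^2)(z^3-sz^2)+s^3(s-p)z+s^5,& \text{if } q\ne0 \text{ and } s\neq 0,\\ r z^3-ps^2z+s^4,& \text{if } q=0 \text{ and } s\ne0,\\ rz-q^2,& \text{if } s=0.\end{cases}$$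
   Context: $D_n=[d_{ij}]_{1\le i,j\le n}$ is the real symmetric matrix with $d_{11}=d_{nn}=r$, $d_{ii}=p$ for $2\le i\le n-1$, $d_{ij}=q$ if $|i-j|=1$, $d_{ij}=s$ if $|i-j|=2$, and $d_{ij}=0$ otherwise. Square roots may be complex. The coefficients $\kappa_j$ are those in the closed formulas $e_n=\sum_j\kappa_j\mu_j^n$, $e_n=\sum_j\kappa_j\nu_j^n$, $e_n=\sum_j\kappa_j\xi_j^n$ (in the respective cases) for the determinant $e_n$ of the $n\times n$ matrix $E_n$ that has the same entries as $D_n$ except that its $(n,n)$ entry is $p$. They are as follows. **Case $q\ne0$, $s\ne0$.** Put $\alpha=\sqrt{(p+2s)^2-4q^2}$, $\beta_1=\sqrt{2(p-2s)(p+2s-\alpha)-4q^2}$, $\beta_2=\sqrt{2(p-2s)(p+2s+\alpha)-4q^2}$, and $$\mu_1=\tfrac{p-2s-\alpha-\beta_1}{4},\ \mu_2=\tfrac{p-2s-\alpha+\beta_1}{4},\ \mu_3=\tfrac{p-2s+\alpha-\beta_2}{4},\ \mu_4=\tfrac{p-2s+\alpha+\beta_2}{4},\ \mu_5=s.$$ (1) If $q^2\notin\{4s(p-2s),(p+2s)^2/4\}$: $\kappa_1=K(-\alpha,\beta_2,-\beta_1)$, $\kappa_2=K(-\alpha,\beta_2,\beta_1)$, $\kappa_3=K(\alpha,\beta_1,-\beta_2)$, $\kappa_4=K(\alpha,\beta_1,\beta_2)$, $\kappa_5=\frac{2s(r+s-p)}{q^2-4s(p-2s)}$, where $$K(x,y,z)=\frac{64\,N(x,z)}{z\,(p-2s+x+z)\,(p-6s+x+z)\,((2x+z)^2-y^2)},$$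 $$\begin{aligned}N(x,z)=\ &2s^4(2s+3p+x+z)+ps^2\big(4q^2-2s(p-x)-(p+x)(2p+z)\big)\\&-2sq^2\big(4q^2-2p^2-(p-2s)(2x+z)-xz\big)\\&+r\big(4q^4-q^2(p+x)(2p+z)+2sq^2(p-2s+3x+2z)-2s^2p(p+x+z)-2s^3(p-2s-x+z)\big)\\&+(q^2-pr)\big(2s^2(2s+3p+x)+2q^2(3p-4s+x+z)-(s(p-x)+p(p+x))(2p+z)\big).\end{aligned}$$ (2) If $q^2=4s(p-2s)$ and $p\neq 6s$, put $\gamma=\sqrt{(p-6s)(p-2s)}$, $$K_1=\frac{p^2-p(r+8s)+2s(2r+11s)}{(p-6s)^2},\quad K_2(j)=\frac{p-r-js}{p-6s}\ (j=1,2),\quad K_3(z)=\frac{2s^2(p-2s)^2(p-4s+z)\big((r-p)(p-4s+z)+2s^2\big)}{z\,\big(4s(3s-z)+p(p-8s+z)\big)^3}.$$ If $p>6s$ (then $\mu_1=\mu_2=\mu_5=s$, $\mu_3=(p-4s-\gamma)/2$, $\mu_4=(p-4s+\gamma)/2$): $\kappa_1=K_1$, $\kappa_2=2n\,K_2(2)$, $\kappa_3=K_3(\gamma)$, $\kappa_4=K_3(-\gamma)$, $\kappa_5=n^2K_2(1)$. If $p<6s$ (then $\mu_1=(p-4s-\gamma)/2$, $\mu_2=(p-4s+\gamma)/2$, $\mu_3=\mu_4=\mu_5=s$): $\kappa_1=K_3(\gamma)$, $\kappa_2=K_3(-\gamma)$, $\kappa_3=K_1$, $\kappa_4=2n\,K_2(2)$,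 $\kappa_5=n^2K_2(1)$. (3) If $q^2=(p+2s)^2/4$ and $p\ne6s$, put $\delta=\sqrt{(p-6s)(p+2s)}$ (then $\mu_1=\mu_3=(p-2s-\delta)/4$, $\mu_2=\mu_4=(p-2s+\delta)/4$, $\mu_5=s$): $\kappa_1=K_4(\delta)$, $\kappa_2=K_4(-\delta)$, $\kappa_3=n\,K_5(\delta)$, $\kappa_4=n\,K_5(-\delta)$, $\kappa_5=\frac{8s(r+s-p)}{(p-6s)^2}$, where $K_4(z)=\dfrac{8N_4(z)}{z(p-6s)(p-2s-z)^2(p-6s-z)^2}$, $K_5(z)=\dfrac{4N_5(z)}{z^2(p-6s-z)(p-2s-z)^2}$, $$\begin{aligned}N_4(z)=\ &p^5(12s-p+z)-2p^4s(24s-4r+5z)-4p^3s\big(2r(10s+z)-s(16s+9z)\big)\\&+8p^2s^2\big(4r(5s+2z)+s(20s-7z)\big)+16ps^3\big(2r(8s-3z)-5s(8s+z)\big)-32s^4\big(2r(6s+z)+s(6s-7z)\big),\end{aligned}$$ $$\begin{aligned}N_5(z)=\ &p^4(2r+4s-p+z)-2p^3\big(r(6s+z)-s(6s-z)\big)-8p^2s\big(r(s-z)+s(s+z)\big)\\&+8ps^2\big(r(8s+z)-s(6s+z)\big)-16s^3\big(4s^2-r(2s-z)\big).\end{aligned}$$ (4) If $q^2\in\{4s(p-2s),(p+2s)^2/4\}$ and $p=6s$ (then all $\mu_j=s$): $\kappa_1=1$, $\kappa_2=n\frac{r+8s}{6s}$, $\kappa_3=n^2\frac{5r-7s}{12s}$,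 $\kappa_4=n^3\frac{r-4s}{3s}$, $\kappa_5=n^4\frac{r-5s}{12s}$. **Case $q=0$, $s\ne0$.** $\nu_1=-s$, $\nu_2=s$, $\nu_3=\frac12(p-\sqrt{p^2-4s^2})$, $\nu_4=\frac12(p+\sqrt{p^2-4s^2})$. If $p^2\ne4s^2$: $\kappa_1=K_6(1)$, $\kappa_2=K_6(-1)$, $\kappa_3=K_7(1)$, $\kappa_4=K_7(-1)$ with $$K_6(j)=\frac{p-r+js}{2(p+2js)},\qquad K_7(j)=\frac{p^3r-p^2s^2-3prs^2+2s^4+j(ps^2+rs^2-p^2r)\sqrt{p^2-4s^2}}{(p^2-4s^2)\,(p^2-2s^2-jp\sqrt{p^2-4s^2})}.$$ If $p=2s$: $\kappa_1=\frac{3s-r}{8s}$, $\kappa_2=\frac{r+5s}{8s}$, $\kappa_3=n\frac{r}{2s}$, $\kappa_4=n^2\frac{r-s}{4s}$. If $p=-2s$: $\kappa_1=\frac{5s-r}{8s}$, $\kappa_2=\frac{r+3s}{8s}$, $\kappa_3=-n\frac{r}{2s}$, $\kappa_4=-n^2\frac{r+s}{4s}$. **Case $q\ne0$, $s=0$.** $\xi_1=\frac{p-\sqrt{p^2-4q^2}}2$, $\xi_2=\frac{p+\sqrt{p^2-4q^2}}2$. If $p^2\ne4q^2$: $\kappa_1=\frac{p-2r+\sqrt{p^2-4q^2}}{2\sqrt{p^2-4q^2}}$, $\kappa_2=\frac{2r-p+\sqrt{p^2-4q^2}}{2\sqrt{p^2-4q^2}}$. If $p^2=4q^2$: $\kappa_1=1$,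 $\kappa_2=n\frac{2r-p}{p}$.
   Formalization: Where some κ_j depend on n (repeated roots) the printed formula fails (p=2,q=1,r=3,s=0,n=3: 14, but det D_3=12). There, in the expansion of f(z_j)z_j^{n-k} (k=5,4,2 by case) into powers of z_j, the coefficient κ_j is taken at the exponent of each power instead of at n. *)

theory Defs
  imports "Jordan_Normal_Form.Determinant" "HOL.Complex"
begin

(* Rows and columns of a mat are numbered from 0, so the perturbed corners sit at 0 and n - 1. *)
definition D_mat :: "real \<Rightarrow> real \<Rightarrow> real \<Rightarrow> real \<Rightarrow> nat \<Rightarrow> real mat" where
  "D_mat p q r s n = mat n n (\<lambda>(i, j).
     if i = j then (if i = 0 \<or> i = n - 1 then r else p)
     else if \<bar>int i - int j\<bar> = 1 then q
     else if \<bar>int i - int j\<bar> = 2 then s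
     else 0)"

(* In the definitions with complex parameters p, q, r, s, these are always instantiated with
   the images of the real parameters.  Square roots are principal values. *)

definition f_poly :: "complex \<Rightarrow> complex \<Rightarrow> complex \<Rightarrow> complex \<Rightarrow> complex poly" where
  "f_poly p q r s =
     (if s = 0 then monom r 1 - monom (q^2) 0
      else if q = 0 then monom r 3 - monom (p * s^2) 1 + monom (s^4) 0
      else monom (r - s) 4 + smult (p * s - q^2) (monom 1 3 - monom s 2)
             + monom (s^3 * (s - p)) 1 + monom (s^5) 0)"


subsection \<open>Both \<open>q\<close> and \<open>s\<close> nonzero\<close>

definition alpha :: "complex \<Rightarrow> complex \<Rightarrow> complex \<Rightarrow> complex" where
  "alpha p q s = csqrt ((p + 2*s)^2 - 4*q^2)"

definition beta1 :: "complex \<Rightarrow> complex \<Rightarrow> complex \<Rightarrow> complex" where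
  "beta1 p q s = csqrt (2*(p - 2*s)*(p + 2*s - alpha p q s) - 4*q^2)"

definition beta2 :: "complex \<Rightarrow> complex \<Rightarrow> complex \<Rightarrow> complex" where
  "beta2 p q s = csqrt (2*(p - 2*s)*(p + 2*s + alpha p q s) - 4*q^2)"

definition mu :: "complex \<Rightarrow> complex \<Rightarrow> complex \<Rightarrow> nat \<Rightarrow> complex" where
  "mu p q s j =
     [(p - 2*s - alpha p q s - beta1 p q s) / 4,
      (p - 2*s - alpha p q s + beta1 p q s) / 4,
      (p - 2*s + alpha p q s - beta2 p q s) / 4,
      (p - 2*s + alpha p q s + beta2 p q s) / 4,
      s] ! (j - 1)"

definition N_fun :: "complex \<Rightarrow> complex \<Rightarrow> complex \<Rightarrow> complex \<Rightarrow> complex \<Rightarrow> complex \<Rightarrow> complex" where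
  "N_fun p q r s x z =
     2*s^4*(2*s + 3*p + x + z)
     + p*s^2*(4*q^2 - 2*s*(p - x) - (p + x)*(2*p + z))
     - 2*s*q^2*(4*q^2 - 2*p^2 - (p - 2*s)*(2*x + z) - x*z)
     + r*(4*q^4 - q^2*(p + x)*(2*p + z) + 2*s*q^2*(p - 2*s + 3*x + 2*z)
          - 2*s^2*p*(p + x + z) - 2*s^3*(p - 2*s - x + z))
     + (q^2 - p*r)*(2*s^2*(2*s + 3*p + x) + 2*q^2*(3*p - 4*s + x + z)
          - (s*(p - x) + p*(p + x))*(2*p + z))"

definition K_fun ::
  "complex \<Rightarrow> complex \<Rightarrow> complex \<Rightarrow> complex \<Rightarrow> complex \<Rightarrow> complex \<Rightarrow> complex \<Rightarrow> complex" where
  "K_fun p q r s x y z =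
     64 * N_fun p q r s x z /
     (z * (p - 2*s + x + z) * (p - 6*s + x + z) * ((2*x + z)^2 - y^2))"

definition gam :: "complex \<Rightarrow> complex \<Rightarrow> complex" where
  "gam p s = csqrt ((p - 6*s)*(p - 2*s))"

definition K1 :: "complex \<Rightarrow> complex \<Rightarrow> complex \<Rightarrow> complex" where
  "K1 p r s = (p^2 - p*(r + 8*s) + 2*s*(2*r + 11*s)) / (p - 6*s)^2"

definition K2 :: "complex \<Rightarrow> complex \<Rightarrow> complex \<Rightarrow> complex \<Rightarrow> complex" where
  "K2 p r s j = (p - r - j*s) / (p - 6*s)"

definition K3 :: "complex \<Rightarrow> complex \<Rightarrow> complex \<Rightarrow> complex \<Rightarrow> complex" where
  "K3 p r s z =
     2*s^2*(p - 2*s)^2*(p - 4*s + z)*((r - p)*(p - 4*s + z) + 2*s^2) /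
     (z * (4*s*(3*s - z) + p*(p - 8*s + z))^3)"

definition del :: "complex \<Rightarrow> complex \<Rightarrow> complex" where
  "del p s = csqrt ((p - 6*s)*(p + 2*s))"

definition N4 :: "complex \<Rightarrow> complex \<Rightarrow> complex \<Rightarrow> complex \<Rightarrow> complex" where
  "N4 p r s z =
     p^5*(12*s - p + z) - 2*p^4*s*(24*s - 4*r + 5*z)
     - 4*p^3*s*(2*r*(10*s + z) - s*(16*s + 9*z))
     + 8*p^2*s^2*(4*r*(5*s + 2*z) + s*(20*s - 7*z))
     + 16*p*s^3*(2*r*(8*s - 3*z) - 5*s*(8*s + z))
     - 32*s^4*(2*r*(6*s + z) + s*(6*s - 7*z))"

definition N5 :: "complex \<Rightarrow> complex \<Rightarrow> complex \<Rightarrow> complex \<Rightarrow> complex" where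
  "N5 p r s z =
     p^4*(2*r + 4*s - p + z) - 2*p^3*(r*(6*s + z) - s*(6*s - z))
     - 8*p^2*s*(r*(s - z) + s*(s + z))
     + 8*p*s^2*(r*(8*s + z) - s*(6*s + z))
     - 16*s^3*(4*s^2 - r*(2*s - z))"

definition K4 :: "complex \<Rightarrow> complex \<Rightarrow> complex \<Rightarrow> complex \<Rightarrow> complex" where
  "K4 p r s z = 8 * N4 p r s z / (z * (p - 6*s) * (p - 2*s - z)^2 * (p - 6*s - z)^2)"

definition K5 :: "complex \<Rightarrow> complex \<Rightarrow> complex \<Rightarrow> complex \<Rightarrow> complex" where
  "K5 p r s z = 4 * N5 p r s z / (z^2 * (p - 6*s - z) * (p - 2*s - z)^2)"

definition kappa_mu_generic ::
  "complex \<Rightarrow> complex \<Rightarrow> complex \<Rightarrow> complex \<Rightarrow> complex list" where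
  "kappa_mu_generic p q r s =
     (let \<alpha> = alpha p q s; \<beta>\<^sub>1 = beta1 p q s; \<beta>\<^sub>2 = beta2 p q s in
      [K_fun p q r s (-\<alpha>) \<beta>\<^sub>2 (-\<beta>\<^sub>1),
       K_fun p q r s (-\<alpha>) \<beta>\<^sub>2 \<beta>\<^sub>1,
       K_fun p q r s \<alpha> \<beta>\<^sub>1 (-\<beta>\<^sub>2),
       K_fun p q r s \<alpha> \<beta>\<^sub>1 \<beta>\<^sub>2,
       2*s*(r + s - p) / (q^2 - 4*s*(p - 2*s))])"

definition kappa_mu_2_gt :: "complex \<Rightarrow> complex \<Rightarrow> complex \<Rightarrow> nat \<Rightarrow> complex list" where
  "kappa_mu_2_gt p r s n =
     [K1 p r s, 2 * of_nat n * K2 p r s 2, K3 p r s (gam p s), K3 p r s (- gam p s),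
      of_nat n ^ 2 * K2 p r s 1]"

definition kappa_mu_2_lt :: "complex \<Rightarrow> complex \<Rightarrow> complex \<Rightarrow> nat \<Rightarrow> complex list" where
  "kappa_mu_2_lt p r s n =
     [K3 p r s (gam p s), K3 p r s (- gam p s), K1 p r s, 2 * of_nat n * K2 p r s 2,
      of_nat n ^ 2 * K2 p r s 1]"

definition kappa_mu_3 :: "complex \<Rightarrow> complex \<Rightarrow> complex \<Rightarrow> nat \<Rightarrow> complex list" where
  "kappa_mu_3 p r s n =
     [K4 p r s (del p s), K4 p r s (- del p s),
      of_nat n * K5 p r s (del p s), of_nat n * K5 p r s (- del p s),
      8*s*(r + s - p) / (p - 6*s)^2]"

definition kappa_mu_4 :: "complex \<Rightarrow> complex \<Rightarrow> nat \<Rightarrow> complex list" where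
  "kappa_mu_4 r s n =
     [1, of_nat n * ((r + 8*s) / (6*s)), of_nat n ^ 2 * ((5*r - 7*s) / (12*s)),
      of_nat n ^ 3 * ((r - 4*s) / (3*s)), of_nat n ^ 4 * ((r - 5*s) / (12*s))]"

(* If p = 6 s, the two exceptional values of q^2 coincide; otherwise they are different. *)
definition kappa_mu :: "real \<Rightarrow> real \<Rightarrow> real \<Rightarrow> real \<Rightarrow> nat \<Rightarrow> nat \<Rightarrow> complex" where
  "kappa_mu p q r s n j =
     (if q^2 \<notin> {4*s*(p - 2*s), (p + 2*s)^2 / 4}
        then kappa_mu_generic (of_real p) (of_real q) (of_real r) (of_real s)
      else if p = 6*s then kappa_mu_4 (of_real r) (of_real s) n
      else if q^2 = 4*s*(p - 2*s) then
        (if p > 6*s then kappa_mu_2_gt (of_real p) (of_real r) (of_real s) n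
         else kappa_mu_2_lt (of_real p) (of_real r) (of_real s) n)
      else kappa_mu_3 (of_real p) (of_real r) (of_real s) n) ! (j - 1)"


subsection \<open>Only \<open>s\<close> nonzero\<close>

definition nu :: "complex \<Rightarrow> complex \<Rightarrow> nat \<Rightarrow> complex" where
  "nu p s j =
     [- s, s, (p - csqrt (p^2 - 4*s^2)) / 2, (p + csqrt (p^2 - 4*s^2)) / 2] ! (j - 1)"

definition K6 :: "complex \<Rightarrow> complex \<Rightarrow> complex \<Rightarrow> complex \<Rightarrow> complex" where
  "K6 p r s j = (p - r + j*s) / (2*(p + 2*j*s))"

definition K7 :: "complex \<Rightarrow> complex \<Rightarrow> complex \<Rightarrow> complex \<Rightarrow> complex" where
  "K7 p r s j =
     (p^3*r - p^2*s^2 - 3*p*r*s^2 + 2*s^4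
        + j*(p*s^2 + r*s^2 - p^2*r)*csqrt (p^2 - 4*s^2)) /
     ((p^2 - 4*s^2) * (p^2 - 2*s^2 - j*p*csqrt (p^2 - 4*s^2)))"

definition kappa_nu :: "complex \<Rightarrow> complex \<Rightarrow> complex \<Rightarrow> nat \<Rightarrow> nat \<Rightarrow> complex" where
  "kappa_nu p r s n j =
     (if p^2 \<noteq> 4*s^2 then [K6 p r s 1, K6 p r s (-1), K7 p r s 1, K7 p r s (-1)]
      else if p = 2*s then
        [(3*s - r) / (8*s), (r + 5*s) / (8*s),
         of_nat n * (r / (2*s)), of_nat n ^ 2 * ((r - s) / (4*s))]
      else
        [(5*s - r) / (8*s), (r + 3*s) / (8*s),
         - of_nat n * (r / (2*s)), - (of_nat n ^ 2) * ((r + s) / (4*s))]) ! (j - 1)"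


subsection \<open>Only \<open>q\<close> nonzero\<close>

definition xi :: "complex \<Rightarrow> complex \<Rightarrow> nat \<Rightarrow> complex" where
  "xi p q j = [(p - csqrt (p^2 - 4*q^2)) / 2, (p + csqrt (p^2 - 4*q^2)) / 2] ! (j - 1)"

definition kappa_xi :: "complex \<Rightarrow> complex \<Rightarrow> complex \<Rightarrow> nat \<Rightarrow> nat \<Rightarrow> complex" where
  "kappa_xi p q r n j =
     (if p^2 \<noteq> 4*q^2 then
        [(p - 2*r + csqrt (p^2 - 4*q^2)) / (2 * csqrt (p^2 - 4*q^2)),
         (2*r - p + csqrt (p^2 - 4*q^2)) / (2 * csqrt (p^2 - 4*q^2))]
      else [1, of_nat n * ((2*r - p) / p)]) ! (j - 1)"


subsection \<open>Coefficients that depend on the index\<close>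

(* The coefficients k_j belong to closed formulas e_m = (SUM j. k_j(m) * z_j^m), and det D_n is
   the combination (SUM i. coeff f i * e_(m+i)) for a fixed offset m = n - 5, n - 4 or n - 2.
   If k_j is constant, its share in that combination is k_j * f(z_j) * z_j^m.
   If k_j depends on the index, then the factor multiplying z_j^(m+i) is k_j(m+i): in the
   product k_j * f(z_j) * z_j^m, expanded into powers of z_j, the index in k_j is the exponent
   of the accompanying power of z_j.  Keeping k_j = k_j(n) in all powers gives a wrong value: for
   p = 2, q = 1, r = 3, s = 0, n = 3 it yields 14, whereas det D_3 = 12. *)
definition index_term :: "(nat \<Rightarrow> complex) \<Rightarrow> complex poly \<Rightarrow> complex \<Rightarrow> nat \<Rightarrow> complex" where
  "index_term k f z m = (\<Sum>i\<le>degree f. coeff f i * k (m + i) * z ^ (m + i))"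

lemma index_term_const: "index_term (\<lambda>_. c) f z m = c * poly f z * z ^ m"
  by (simp add: index_term_def poly_altdef sum_distrib_left sum_distrib_right
        power_add mult_ac)

end

theory Submission
  imports Defs
begin

text \<open>
  Let \<open>e n\<close> be the determinant of the \<open>n \<times> n\<close> band matrix in which only the top left corner is perturbed.
  The matrix in question differs from it in the last diagonal entry alone, so its determinant is
  \<open>e n + (r - p) * e (n - 1)\<close> (\<open>det_D_mat\<close>).

  Expanding along the last row never leaves the finite family of minors that differ from a leading
  minor in the last two columns.  Eliminating all but the leading minors gives a recurrence of order 5
  for \<open>e\<close>, valid from the empty determinant \<open>e 0 = 1\<close> on (\<open>lead_det_recurrence\<close>).  Let \<open>\<chi>\<close> be its
  characteristic polynomial.  The polynomial \<open>f\<close> of the statement is \<open>z\<^sup>5 + (r - p) * z\<^sup>4 - \<chi>\<close>, so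
  replacing each power \<open>z\<^sup>i\<close> in \<open>f\<close> by \<open>e (n - 5 + i)\<close> gives \<open>e n + (r - p) * e (n - 1)\<close> again
  (\<open>f_poly_combination\<close>).  When \<open>q\<close> or \<open>s\<close> is zero, the recurrence has order 4 or 2, and \<open>f\<close> is
  obtained from the smaller characteristic polynomial in the same way.  It remains to prove that
  \<open>e n = (\<Sum>j. \<kappa>\<^sub>j * z\<^sub>j ^ n)\<close> with the listed roots and coefficients, which for repeated roots depend on \<open>n\<close>.

  One root of \<open>\<chi>\<close> is \<open>s\<close>.  The quartic cofactor is invariant under \<open>z \<mapsto> s\<^sup>2 / z\<close>, so it splits into two
  quadratic factors with constant term \<open>s\<^sup>2\<close>; this explains the nested square roots.  If the roots are
  distinct, then the coefficient of a root is found by applying to \<open>e\<close> the difference operators of all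
  other roots (\<open>lagrange_closed_form\<close>); the polynomial \<open>N_fun\<close> is what this gives
  (\<open>N_fun_residue\<close>).  If roots coincide, then the remaining square root disappears in the
  parametrization by one root \<open>a\<close> and \<open>t = s / a\<close>, and the closed formula is checked against the
  recurrence and the five initial values (\<open>corner_seq_triple_root\<close>, \<open>corner_seq_two_double_roots\<close>,
  \<open>corner_seq_quintuple_root\<close>).
\<close>

section \<open>Determinants of banded matrices by last-row expansion\<close>

text \<open>
  All determinants below live on the first rows of one infinite array \<open>a\<close>.  The columns are the
  first \<open>n\<close> ones followed by \<open>x\<close> and \<open>y\<close>, because in an array of bandwidth 2 the expansion along
  the last row only ever changes the last two columns.
\<close>
definition corner_minor :: "(nat \<Rightarrow> nat \<Rightarrow> 'a :: comm_ring_1) \<Rightarrow> nat \<Rightarrow> nat \<Rightarrow> nat \<Rightarrow> 'a" where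
  "corner_minor a n x y =
     det (mat (n + 2) (n + 2) (\<lambda>(i, j). a i (if j < n then j else if j = n then x else y)))"

lemma det_last_row:
  fixes b :: "nat \<Rightarrow> nat \<Rightarrow> 'a :: comm_ring_1"
  shows "det (mat (Suc n) (Suc n) (\<lambda>(i, j). b i j)) =
    (\<Sum>j\<le>n. (-1) ^ (n + j) * b n j *
       det (mat n n (\<lambda>(i, k). b i (if k < j then k else Suc k))))"
proof -
  let ?A = "mat (Suc n) (Suc n) (\<lambda>(i, j). b i j)"
  have "det ?A = (\<Sum>j<Suc n. ?A $$ (n, j) * cofactor ?A n j)"
    by (rule laplace_expansion_row) auto
  also have "\<dots> = (\<Sum>j\<le>n. (-1) ^ (n + j) * b n j *
       det (mat n n (\<lambda>(i, k). b i (if k < j then k else Suc k))))"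
    unfolding lessThan_Suc_atMost
  proof (rule sum.cong[OF refl])
    fix j assume j: "j \<in> {..n}"
    have "mat_delete ?A n j = mat n n (\<lambda>(i, k). b i (if k < j then k else Suc k))"
      by (rule eq_matI) (auto simp: mat_delete_def)
    then show "?A $$ (n, j) * cofactor ?A n j = (-1) ^ (n + j) * b n j *
       det (mat n n (\<lambda>(i, k). b i (if k < j then k else Suc k)))"
      using j by (simp add: cofactor_def)
  qed
  finally show ?thesis .
qed

lemma corner_minor_0: "corner_minor a 0 x y = a 0 x * a 1 y - a 0 y * a 1 x"
  using det_last_row[of 1 "\<lambda>i j. a i (if j = 0 then x else y)"]
  by (simp add: corner_minor_def numeral_2_eq_2 det_single algebra_simps)

text \<open>
  In the last row, the entries in columns \<open>0, \<dots>, n - 1\<close> vanish, so only three terms of the Laplace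
  expansion remain, and each deleted column leaves the first \<open>n\<close> columns and two further ones.
\<close>
lemma corner_minor_Suc:
  assumes "\<And>j. j < n \<Longrightarrow> a (n + 2) j = 0"
  shows "corner_minor a (Suc n) x y =
    a (n + 2) y * corner_minor a n n x - a (n + 2) x * corner_minor a n n y
    + a (n + 2) n * corner_minor a n x y"
proof -
  define c where "c = (\<lambda>j. if j < Suc n then j else if j = Suc n then x else y)"
  define m where "m j = det (mat (n + 2) (n + 2) (\<lambda>(i, k). a i (c (if k < j then k else Suc k))))" for j
  let ?t = "\<lambda>j. (-1) ^ (n + 2 + j) * a (n + 2) (c j) * m j"
  have "corner_minor a (Suc n) x y = (\<Sum>j\<le>n + 2. ?t j)"
    using det_last_row[of "n + 2" "\<lambda>i j. a i (c j)"] by (simp add: corner_minor_def c_def m_def)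
  also have "\<dots> = (\<Sum>j\<in>{n, n + 1, n + 2}. ?t j)"
    using assms by (intro sum.mono_neutral_right) (auto simp: c_def)
  also have "\<dots> = a (n + 2) n * m n - a (n + 2) x * m (n + 1) + a (n + 2) y * m (n + 2)"
    by (simp add: c_def)
  also have "m n = corner_minor a n x y"
    unfolding corner_minor_def m_def c_def
    by (rule arg_cong[where f = det], rule eq_matI) auto
  also have "m (n + 1) = corner_minor a n n y"
    unfolding corner_minor_def m_def c_def
    by (rule arg_cong[where f = det], rule eq_matI) auto
  also have "m (n + 2) = corner_minor a n n x"
    unfolding corner_minor_def m_def c_def
    by (rule arg_cong[where f = det], rule eq_matI) auto
  finally show ?thesis by simp
qed

lemma corner_minor_cong:
  assumes "\<And>i j. i < n + 2 \<Longrightarrow> a i j = b i j"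
  shows "corner_minor a n x y = corner_minor b n x y"
  unfolding corner_minor_def by (rule arg_cong[where f = det], rule eq_matI) (auto simp: assms)

text \<open>
  The infinite array whose leading \<open>n \<times> n\<close> block is the pentadiagonal Toeplitz matrix with only its
  top left corner perturbed.
\<close>
definition band :: "'a \<Rightarrow> 'a \<Rightarrow> 'a \<Rightarrow> 'a \<Rightarrow> nat \<Rightarrow> nat \<Rightarrow> 'a :: comm_ring_1" where
  "band p q r s i j =
     (if i = j then (if i = 0 then r else p)
      else if \<bar>int i - int j\<bar> = 1 then q
      else if \<bar>int i - int j\<bar> = 2 then s
      else 0)"

definition lead_det :: "'a \<Rightarrow> 'a \<Rightarrow> 'a \<Rightarrow> 'a \<Rightarrow> nat \<Rightarrow> 'a :: comm_ring_1" where
  "lead_det p q r s n = det (mat n n (\<lambda>(i, j). band p q r s i j))"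

lemma lead_det_corner_minor:
  "lead_det p q r s (n + 2) = corner_minor (band p q r s) n n (n + 1)"
  unfolding lead_det_def corner_minor_def
  by (rule arg_cong[where f = det], rule eq_matI) (auto simp: less_Suc_eq)

lemma band_minor_Suc:
  fixes p q r s :: "'a :: comm_ring_1"
  defines "M \<equiv> corner_minor (band p q r s)"
  shows "M (Suc n) x y = band p q r s (n + 2) y * M n n x - band p q r s (n + 2) x * M n n y
           + s * M n x y"
proof -
  have "band p q r s (n + 2) n = s"
    by (simp add: band_def)
  then show ?thesis
    unfolding M_def by (subst corner_minor_Suc) (auto simp: band_def)
qed

text \<open>
  The first \<open>n + 2\<close> rows reach no further than column \<open>n + 3\<close>, so the last column of the minor is zero.
\<close>
lemma band_minor_zero:
  "y \<ge> n + 4 \<Longrightarrow> corner_minor (band p q r s) n x y = 0"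
proof (induction n arbitrary: x)
  case 0
  then show ?case by (simp add: corner_minor_0 band_def)
next
  case (Suc n)
  then have "band p q r s (n + 2) y = 0"
    by (simp add: band_def)
  with Suc show ?case by (simp add: band_minor_Suc)
qed

text \<open>
  The minor that is left over when the leading block of size \<open>n + 2\<close> uses column \<open>n + 2\<close> in place of
  column \<open>n + 1\<close>.  All other minors that occur reduce to this one and the leading one.
\<close>
definition gap_det :: "'a \<Rightarrow> 'a \<Rightarrow> 'a \<Rightarrow> 'a \<Rightarrow> nat \<Rightarrow> 'a :: comm_ring_1" where
  "gap_det p q r s n = corner_minor (band p q r s) n n (n + 2)"

lemma lead_det_0: "lead_det p q r s 0 = 1"
  by (simp add: lead_det_def)

lemma lead_det_1: "lead_det p q r s (Suc 0) = r"
  by (simp add: lead_det_def band_def det_single)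

lemma band_entries [simp]:
  "band p q r s (Suc n) (Suc n) = p"
  "band p q r s n (Suc n) = q"
  "band p q r s (Suc n) n = q"
  "band p q r s n (Suc (Suc n)) = s"
  "band p q r s (Suc (Suc n)) n = s"
  "band p q r s n (Suc (Suc (Suc n))) = 0"
  "band p q r s 0 0 = r"
  by (simp_all add: band_def)

lemma lead_det_2: "lead_det p q r s 2 = p * r - q^2"
  using lead_det_corner_minor[of p q r s 0]
  by (simp add: corner_minor_0 power2_eq_square algebra_simps numeral_2_eq_2)

lemma lead_det_3: "lead_det p q r s 3 = p * (p * r - q^2) - p * s^2 - q^2 * (r - 2 * s)"
  using lead_det_corner_minor[of p q r s 1]
  by (simp add: band_minor_Suc corner_minor_0 power2_eq_square algebra_simps
      eval_nat_numeral)

lemma minor_far_gap: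
  "corner_minor (band p q r s) n n (n + 3) = s * lead_det p q r s (n + 1)"
proof (cases n)
  case 0
  then show ?thesis by (simp add: corner_minor_0 lead_det_1 numeral_3_eq_3)
next
  case (Suc m)
  then show ?thesis
    using lead_det_corner_minor[of p q r s m]
    by (simp add: band_minor_Suc band_minor_zero numeral_3_eq_3)
qed

lemma minor_two_gaps:
  "corner_minor (band p q r s) (Suc n) (n + 2) (n + 4) = s * gap_det p q r s n"
  by (simp add: band_minor_Suc band_minor_zero gap_det_def eval_nat_numeral)

lemma minor_far_pair:
  "corner_minor (band p q r s) n (n + 2) (n + 3) = s^2 * lead_det p q r s n"
proof (cases n)
  case 0
  then show ?thesis by (simp add: corner_minor_0 lead_det_0 eval_nat_numeral)
next
  case (Suc m)
  then show ?thesis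
    using minor_far_gap[of p q r s m]
    by (simp add: band_minor_Suc band_minor_zero eval_nat_numeral mult.assoc)
qed

lemma gap_det_0: "gap_det p q r s 0 = q * (r - s)"
  by (simp add: gap_det_def corner_minor_0 eval_nat_numeral algebra_simps)

text \<open>
  Expanding twice gives the second-order relation
  \<open>g (n + 1) = q e (n + 2) - q s e (n + 1) + s\<^sup>2 g (n - 1)\<close>, where \<open>e\<close> and \<open>g\<close> stand for \<open>lead_det\<close> and
  \<open>gap_det\<close>.  It says that the error in the relation below is multiplied by \<open>s\<close> when \<open>n\<close> grows by one, and the
  initial error is zero.  This loss of one order is the reason why
  the final recurrence has order 5 and not 6.
\<close>
lemma gap_det_Suc: "gap_det p q r s (Suc n) = q * lead_det p q r s (n + 2) - s * gap_det p q r s n"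
proof (induction n)
  case 0
  have "gap_det p q r s (Suc 0) = q * (p * r - q^2) - s * (q * (r - s))"
    by (simp add: gap_det_def band_minor_Suc corner_minor_0 algebra_simps eval_nat_numeral)
  then show ?case
    by (simp add: gap_det_0 lead_det_2[unfolded numeral_2_eq_2] power2_eq_square)
next
  case (Suc n)
  have "gap_det p q r s (Suc (Suc n)) =
     q * lead_det p q r s (n + 3) - q * (s * lead_det p q r s (n + 2)) + s * (s * gap_det p q r s n)"
    using lead_det_corner_minor[of p q r s "Suc n"] minor_far_gap[of p q r s "Suc n"]
      minor_two_gaps[of p q r s n]
    by (simp add: gap_det_def band_minor_Suc[of _ _ _ _ "Suc n"] eval_nat_numeral)
  also have "\<dots> = q * lead_det p q r s (n + 3) - s * gap_det p q r s (Suc n)"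
    by (simp add: Suc algebra_simps)
  finally show ?case by (simp add: eval_nat_numeral)
qed

lemma minor_shifted_pair:
  "corner_minor (band p q r s) (Suc n) (n + 2) (n + 3) =
     q * gap_det p q r s n - p * s * lead_det p q r s (n + 1) + s^3 * lead_det p q r s n"
  using minor_far_gap[of p q r s n] minor_far_pair[of p q r s n]
  by (simp add: band_minor_Suc gap_det_def eval_nat_numeral algebra_simps)

lemma lead_det_add_3:
  "lead_det p q r s (n + 3) = p * lead_det p q r s (n + 2) - q * gap_det p q r s n
     + s * corner_minor (band p q r s) n (n + 1) (n + 2)"
  using lead_det_corner_minor[of p q r s n] lead_det_corner_minor[of p q r s "Suc n"]
  by (simp add: band_minor_Suc gap_det_def eval_nat_numeral)

text \<open>
  Up to six minors occur, one for each choice of two among the four columns that the last rows reach.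
  Three of them have a single nonzero entry in the last column and are multiples of smaller minors;
  the fourth one to be eliminated here is \<open>minor_shifted_pair\<close>.
\<close>
lemma lead_det_add_4:
  "lead_det p q r s (n + 4) = p * lead_det p q r s (n + 3) - p * s^2 * lead_det p q r s (n + 1)
     + s^4 * lead_det p q r s n - q * (gap_det p q r s (Suc n) - s * gap_det p q r s n)"
proof -
  have "lead_det p q r s (n + 4) = p * lead_det p q r s (n + 3) - q * gap_det p q r s (Suc n)
     + s * corner_minor (band p q r s) (Suc n) (n + 2) (n + 3)"
    using lead_det_add_3[of p q r s "Suc n"] by (simp add: eval_nat_numeral)
  then show ?thesis
    unfolding minor_shifted_pair by (simp add: algebra_simps power2_eq_square power3_eq_cube power4_eq_xxxx)
qed

lemma lead_det_4:
  "lead_det p q r s 4 = p * lead_det p q r s 3 - p * s^2 * r + s^4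
     - q^2 * (lead_det p q r s 2 - 2 * s * r + 2 * s^2)"
  using lead_det_add_4[of p q r s 0] gap_det_Suc[of p q r s 0]
  by (simp add: gap_det_0 lead_det_0 lead_det_1 algebra_simps power2_eq_square numeral_2_eq_2)

text \<open>
  Adding \<open>s\<close> times the relation for \<open>n + 4\<close> to the one for \<open>n + 5\<close> turns every occurrence of the gap
  minors into a sum \<open>g (k + 1) + s g k\<close>, which is a multiple of a leading minor.
\<close>
lemma lead_det_recurrence:
  fixes p q r s :: "'a :: comm_ring_1"
  shows
  "lead_det p q r s (n + 5) = (p - s) * lead_det p q r s (n + 4)
     + (p * s - q^2) * (lead_det p q r s (n + 3) - s * lead_det p q r s (n + 2))
     + s^3 * (s - p) * lead_det p q r s (n + 1) + s^5 * lead_det p q r s n"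
proof -
  have key: "a5 = (p - s) * a4 + (p * s - q^2) * (a3 - s * a2) + s^3 * (s - p) * a1 + s^5 * a0"
    if "a5 = p * a4 - p * s^2 * a2 + s^4 * a1 - q * (g2 - s * g1)" "g2 = q * a3 - s * g1"
      "g1 = q * a2 - s * g0" "a4 = p * a3 - p * s^2 * a1 + s^4 * a0 - q * (g1 - s * g0)"
    for a0 a1 a2 a3 a4 a5 g0 g1 g2 :: 'a
    unfolding that(1,2,4) that(3) by (simp add: algebra_simps eval_nat_numeral)
  have 1: "lead_det p q r s (n + 5) = p * lead_det p q r s (n + 4) - p * s^2 * lead_det p q r s (n + 2)
     + s^4 * lead_det p q r s (n + 1) - q * (gap_det p q r s (n + 2) - s * gap_det p q r s (n + 1))"
    using lead_det_add_4[of p q r s "Suc n"] by (simp add: eval_nat_numeral)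
  have 2: "gap_det p q r s (n + 2) = q * lead_det p q r s (n + 3) - s * gap_det p q r s (n + 1)"
    "gap_det p q r s (n + 1) = q * lead_det p q r s (n + 2) - s * gap_det p q r s n"
    using gap_det_Suc[of p q r s n] gap_det_Suc[of p q r s "Suc n"]
    by (simp_all add: eval_nat_numeral)
  show ?thesis
    using 1 2 lead_det_add_4[of p q r s n]
    unfolding Suc_eq_plus1 by (intro key)
qed

text \<open>
  The determinant is an affine function of the entry in the bottom right corner, and the cofactor of
  that entry is the leading minor of size \<open>n - 1\<close>.
\<close>
lemma det_D_mat:
  assumes "n \<ge> 3"
  shows "det (D_mat p q r s n) = lead_det p q r s n + (r - p) * lead_det p q r s (n - 1)"
proof -
  obtain m where n: "n = m + 3"
    using assms by (metis add.commute le_Suc_ex)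
  define a where "a = (\<lambda>i j. if i = m + 2 \<and> j = m + 2 then r else band p q r s i j)"
  have a_row: "a (m + 2) m = s" "a (m + 2) (m + 1) = q" "a (m + 2) (m + 2) = r"
    by (simp_all add: a_def)
  \<comment> \<open>The changed entry lies in row \<open>m + 2\<close>, below the rows of the minors of index \<open>m\<close>.\<close>
  have a_minor: "corner_minor a m x y = corner_minor (band p q r s) m x y" for x y
    by (rule corner_minor_cong) (auto simp: a_def)
  have "det (D_mat p q r s n) = corner_minor a (Suc m) (m + 1) (m + 2)"
  proof -
    have entry: "(if i = j then if i = 0 \<or> i = n - 1 then r else p
        else if \<bar>int i - int j\<bar> = 1 then q else if \<bar>int i - int j\<bar> = 2 then s else 0) = a i j" for i j
      by (cases "i = j") (simp_all add: n a_def band_def)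
    have "(if j < Suc m then j else if j = Suc m then m + 1 else m + 2) = j" if "j < n" for j
      using that by (simp add: n)
    then show ?thesis
      unfolding D_mat_def corner_minor_def entry
      by (intro arg_cong[where f = det] eq_matI) (simp_all add: n)
  qed
  also have "\<dots> = r * corner_minor (band p q r s) m m (m + 1)
      - q * corner_minor (band p q r s) m m (m + 2) + s * corner_minor (band p q r s) m (m + 1) (m + 2)"
    by (subst corner_minor_Suc, simp add: a_def band_def) (simp only: a_row a_minor)
  also have "\<dots> = lead_det p q r s (m + 3) + (r - p) * lead_det p q r s (m + 2)"
    using lead_det_add_3[of p q r s m] lead_det_corner_minor[of p q r s m]
    by (simp add: gap_det_def algebra_simps)
  finally show ?thesis
    by (simp add: n eval_nat_numeral)
qed

section \<open>The sequence of leading minors\<close>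

text \<open>
  The leading minors, seen as a sequence over an arbitrary field: the recurrence of order 5 and its
  five initial values, which start at the empty determinant.  This characterization is what closed
  formulas are compared with.
\<close>
definition corner_seq :: "'a \<Rightarrow> 'a \<Rightarrow> 'a \<Rightarrow> 'a \<Rightarrow> (nat \<Rightarrow> 'a :: field) \<Rightarrow> bool" where
  "corner_seq p q r s u \<longleftrightarrow>
     u 0 = 1 \<and> u 1 = r \<and> u 2 = p * r - q^2 \<and>
     u 3 = p * (p * r - q^2) - p * s^2 - q^2 * (r - 2 * s) \<and>
     u 4 = p * u 3 - p * s^2 * r + s^4 - q^2 * (p * r - q^2 - 2 * s * r + 2 * s^2) \<and>
     (\<forall>n. u (n + 5) = (p - s) * u (n + 4) + (p * s - q^2) * (u (n + 3) - s * u (n + 2))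
        + s^3 * (s - p) * u (n + 1) + s^5 * u n)"

lemma corner_seq_values:
  assumes "corner_seq p q r s u"
  shows "u 0 = 1" "u 1 = r" "u 2 = p * r - q^2"
    "u 3 = p * (p * r - q^2) - p * s^2 - q^2 * (r - 2 * s)"
    "u 4 = p * u 3 - p * s^2 * r + s^4 - q^2 * (p * r - q^2 - 2 * s * r + 2 * s^2)"
  using assms by (simp_all add: corner_seq_def)

lemma corner_seq_unique:
  assumes "corner_seq p q r s u" "corner_seq p q r s v"
  shows "u n = v n"
proof (induction n rule: less_induct)
  case (less n)
  consider "n \<in> {0, 1, 2, 3, 4}" | m where "n = m + 5"
  proof (cases "n < 5")
    case True
    then show ?thesis using that by fastforce
  next
    case False
    then obtain m where "n = m + 5"
      by (metis add.commute le_Suc_ex not_less)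
    then show ?thesis using that by blast
  qed
  then show ?case
  proof cases
    case 1
    then show ?thesis using assms by (auto simp: corner_seq_def)
  next
    case 2
    then have "u m = v m" "u (m + 1) = v (m + 1)" "u (m + 2) = v (m + 2)" "u (m + 3) = v (m + 3)"
      "u (m + 4) = v (m + 4)"
      using less by auto
    then show ?thesis using assms 2 by (simp add: corner_seq_def)
  qed
qed

text \<open>
  For \<open>q = 0\<close> the characteristic polynomial of order 5 is \<open>z + s\<close> times the one of order 4 below;
  the initial values already satisfy the shorter recurrence, which therefore propagates.
\<close>
lemma corner_seq_q0:
  assumes "corner_seq p 0 r s u"
  shows "u (n + 4) = p * u (n + 3) - p * s^2 * u (n + 1) + s^4 * u n"
proof (induction n)
  case 0
  then show ?case using assms by (simp add: corner_seq_def)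
next
  case (Suc n)
  have "u (n + 5) = (p - s) * u (n + 4) + p * s * (u (n + 3) - s * u (n + 2))
        + s^3 * (s - p) * u (n + 1) + s^5 * u n"
    using assms by (simp add: corner_seq_def)
  also have "\<dots> = p * u (n + 4) - p * s^2 * u (n + 2) + s^4 * u (n + 1)"
    unfolding Suc.IH by (simp add: algebra_simps eval_nat_numeral)
  finally show ?case by (simp add: eval_nat_numeral)
qed

text \<open>
  For \<open>s = 0\<close> the characteristic polynomial is \<open>z\<^sup>3 (z\<^sup>2 - p z + q\<^sup>2)\<close>.  The factor \<open>z\<^sup>3\<close> only delays the
  recurrence by three steps, and the initial values cover these.
\<close>
lemma corner_seq_s0:
  assumes "corner_seq p q r 0 u"
  shows "u (n + 2) = p * u (n + 1) - q^2 * u n"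
proof -
  consider "n = 0" | "n = 1" | "n = 2" | m where "n = m + 3"
  proof (cases "n < 3")
    case True
    then show ?thesis using that by fastforce
  next
    case False
    then obtain m where "n = m + 3"
      by (metis add.commute le_Suc_ex not_less)
    then show ?thesis using that by blast
  qed
  then show ?thesis
  proof cases
    case 1
    then show ?thesis using assms by (simp add: corner_seq_def numeral_2_eq_2)
  next
    case 2
    then have n: "n + 2 = 3" "n + 1 = 2" "n = 1" by auto
    show ?thesis
      unfolding n(1,2) unfolding n(3) using assms unfolding corner_seq_def by simp
  next
    case 3
    then have n: "n + 2 = 4" "n + 1 = 3" "n = 2" by auto
    show ?thesis
      unfolding n(1,2) unfolding n(3) using assms unfolding corner_seq_def by simp
  next
    case (4 m)
    then have n: "n + 2 = m + 5" "n + 1 = m + 4" by auto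
    show ?thesis
      unfolding n unfolding 4 using assms unfolding corner_seq_def by simp
  qed
qed

lemma corner_seq_of_real:
  assumes "corner_seq p q r s u"
  shows "corner_seq (complex_of_real p) (complex_of_real q) (complex_of_real r) (complex_of_real s)
     (\<lambda>n. complex_of_real (u n))"
  unfolding corner_seq_def
proof (intro conjI allI)
  fix n
  have recurrence: "u (n + 5) = (p - s) * u (n + 4) + (p * s - q^2) * (u (n + 3) - s * u (n + 2))
     + s^3 * (s - p) * u (n + 1) + s^5 * u n"
    using assms unfolding corner_seq_def by blast
  show "complex_of_real (u (n + 5)) = (complex_of_real p - complex_of_real s) * complex_of_real (u (n + 4))
     + (complex_of_real p * complex_of_real s - (complex_of_real q)^2)
        * (complex_of_real (u (n + 3)) - complex_of_real s * complex_of_real (u (n + 2)))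
     + (complex_of_real s)^3 * (complex_of_real s - complex_of_real p) * complex_of_real (u (n + 1))
     + (complex_of_real s)^5 * complex_of_real (u n)"
    unfolding recurrence by simp
qed (unfold corner_seq_values[OF assms], simp_all)

lemma corner_seq_lead_det:
  fixes p q r s :: "'a :: field"
  shows "corner_seq p q r s (lead_det p q r s)"
  unfolding corner_seq_def
proof (intro conjI allI)
  show "lead_det p q r s 1 = r"
    using lead_det_1[of p q r s] by simp
  show "lead_det p q r s 4 = p * lead_det p q r s 3 - p * s^2 * r + s^4
     - q^2 * (p * r - q^2 - 2 * s * r + 2 * s^2)"
    using lead_det_4[of p q r s] unfolding lead_det_2 .
qed (rule lead_det_0 lead_det_2 lead_det_3 lead_det_recurrence)+

section \<open>Linear recurrences with distinct roots\<close>

text \<open>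
  The operator \<open>E - z\<close>, where \<open>E\<close> shifts a sequence by one place.  Products of these operators
  represent characteristic polynomials through their roots.
\<close>
definition shift_diff :: "'a :: field \<Rightarrow> (nat \<Rightarrow> 'a) \<Rightarrow> nat \<Rightarrow> 'a" where
  "shift_diff z u n = u (Suc n) - z * u n"

lemma fold_shift_diff_geometric:
  "fold shift_diff ws (\<lambda>n. \<Sum>z\<in>Z. c z * z ^ n) n = (\<Sum>z\<in>Z. c z * (\<Prod>w\<leftarrow>ws. z - w) * z ^ n)"
proof (induction ws arbitrary: c)
  case Nil
  show ?case by simp
next
  case (Cons w ws)
  have "shift_diff w (\<lambda>n. \<Sum>z\<in>Z. c z * z ^ n) = (\<lambda>n. \<Sum>z\<in>Z. (c z * (z - w)) * z ^ n)"
    by (rule ext) (simp add: shift_diff_def sum_distrib_left sum_subtractf[symmetric] algebra_simps)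
  then show ?case
    using Cons.IH[of "\<lambda>z. c z * (z - w)"] by (simp add: mult.assoc)
qed

text \<open>
  By induction on the roots: \<open>(E - z) u\<close> is a combination \<open>\<Sum> c w * w ^ n\<close> without the root \<open>z\<close>.  Dividing
  its coefficients by \<open>w - z\<close> gives a particular solution, and the difference from \<open>u\<close> is geometric
  with ratio \<open>z\<close>.
\<close>
lemma shift_diff_annihilated_imp_geometric:
  assumes "distinct zs" "\<And>n. fold shift_diff zs u n = 0"
  shows "\<exists>c. \<forall>n. u n = (\<Sum>z\<in>set zs. c z * z ^ n)"
  using assms
proof (induction zs arbitrary: u)
  case Nil
  then show ?case by simp
next
  case (Cons z zs)
  obtain c where c: "shift_diff z u n = (\<Sum>w\<in>set zs. c w * w ^ n)" for n
    using Cons.IH[of "shift_diff z u"] Cons.prems by auto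
  define v where "v n = u n - (\<Sum>w\<in>set zs. c w / (w - z) * w ^ n)" for n
  have v_Suc: "v (Suc n) = z * v n" for n
  proof -
    have "(\<Sum>w\<in>set zs. c w / (w - z) * w ^ Suc n) - z * (\<Sum>w\<in>set zs. c w / (w - z) * w ^ n)
        = (\<Sum>w\<in>set zs. c w / (w - z) * (w - z) * w ^ n)"
      by (simp add: sum_distrib_left sum_subtractf[symmetric] algebra_simps diff_divide_distrib)
    also have "\<dots> = (\<Sum>w\<in>set zs. c w * w ^ n)"
      using Cons.prems(1) by (intro sum.cong) auto
    finally show ?thesis
      using c[of n] by (simp add: v_def shift_diff_def algebra_simps)
  qed
  have v: "v n = v 0 * z ^ n" for n
    by (induction n) (simp_all add: v_Suc)
  have "u n = (\<Sum>w\<in>set (z # zs). (if w = z then v 0 else c w / (w - z)) * w ^ n)" for n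
  proof -
    have "(\<Sum>w\<in>set zs. (if w = z then v 0 else c w / (w - z)) * w ^ n)
        = (\<Sum>w\<in>set zs. c w / (w - z) * w ^ n)"
      using Cons.prems(1) by (intro sum.cong) auto
    then show ?thesis
      using v[of n] Cons.prems(1) by (simp add: v_def[of n] algebra_simps)
  qed
  then show ?case by (intro exI allI)
qed

text \<open>
  The operators \<open>E - w\<close> for all roots \<open>w\<close> other than \<open>z\<close> erase every term but the one of \<open>z\<close>, so the
  coefficient of \<open>z\<close> is a quotient of the form known from Lagrange interpolation.  The remaining
  roots may be listed in any order \<open>ws\<close>, which lets one computation serve several roots.
\<close>
lemma lagrange_closed_form:
  assumes "distinct zs" "\<And>n. fold shift_diff zs u n = 0"
  obtains c where "\<And>n. u n = (\<Sum>z\<leftarrow>zs. c z * z ^ n)"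
    and "\<And>z ws. mset (z # ws) = mset zs \<Longrightarrow> c z * (\<Prod>w\<leftarrow>ws. z - w) = fold shift_diff ws u 0"
proof -
  obtain c where c: "u = (\<lambda>n. \<Sum>z\<in>set zs. c z * z ^ n)"
    using shift_diff_annihilated_imp_geometric[OF assms] by auto
  show ?thesis
  proof
    show "u n = (\<Sum>z\<leftarrow>zs. c z * z ^ n)" for n
      using assms(1) by (simp add: c sum_list_distinct_conv_sum_set)
    show "c z * (\<Prod>w\<leftarrow>ws. z - w) = fold shift_diff ws u 0" if perm: "mset (z # ws) = mset zs" for z ws
    proof -
      have set: "set zs = insert z (set ws)"
        using mset_eq_setD[OF perm] by simp
      have "fold shift_diff ws u 0 = (\<Sum>y\<in>set zs. c y * (\<Prod>w\<leftarrow>ws. y - w))"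
        unfolding c fold_shift_diff_geometric by simp
      also have "\<dots> = (\<Sum>y\<in>{z}. c y * (\<Prod>w\<leftarrow>ws. y - w))"
        unfolding set by (intro sum.mono_neutral_right) auto
      finally show ?thesis by simp
    qed
  qed
qed

text \<open>
  A pair of roots enters only through its sum and product, so the square roots in the two roots cancel.
\<close>
lemma shift_diff_pair:
  assumes "c + d = t" "c * d = v"
  shows "shift_diff d (shift_diff c u) = (\<lambda>n. u (n + 2) - t * u (n + 1) + v * u n)"
  by (rule ext) (simp add: shift_diff_def assms[symmetric] algebra_simps)

section \<open>Closed forms for simple characteristic roots\<close>

lemma shift_diff_two_pairs:
  assumes pairs: "a + b = \<sigma>" "a * b = v" "c + d = \<tau>" "c * d = v"
    and sum: "\<sigma> + \<tau> = g" "\<sigma> * \<tau> = h"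
  shows "fold shift_diff [a, b, c, d] u n =
      u (n + 4) - g * u (n + 3) + (2 * v + h) * u (n + 2) - v * g * u (n + 1) + v^2 * u n"
    and "(x - a) * ((x - b) * ((x - c) * (x - d))) =
      x^4 - g * x^3 + (2 * v + h) * x^2 - v * g * x + v^2"
proof -
  show "fold shift_diff [a, b, c, d] u n =
      u (n + 4) - g * u (n + 3) + (2 * v + h) * u (n + 2) - v * g * u (n + 1) + v^2 * u n"
    by (simp add: shift_diff_pair[OF pairs(1,2)] shift_diff_pair[OF pairs(3,4)])
       (simp add: sum[symmetric] algebra_simps eval_nat_numeral)
  have "(x - a) * (x - b) = x^2 - \<sigma> * x + v"
    by (simp add: pairs(1,2)[symmetric] algebra_simps power2_eq_square)
  moreover have "(x - c) * (x - d) = x^2 - \<tau> * x + v"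
    by (simp add: pairs(3,4)[symmetric] algebra_simps power2_eq_square)
  ultimately have "(x - a) * ((x - b) * ((x - c) * (x - d))) = (x^2 - \<sigma> * x + v) * (x^2 - \<tau> * x + v)"
    by (metis mult.assoc)
  then show "(x - a) * ((x - b) * ((x - c) * (x - d))) =
      x^4 - g * x^3 + (2 * v + h) * x^2 - v * g * x + v^2"
    by (simp add: sum[symmetric] algebra_simps eval_nat_numeral)
qed

text \<open>
  The characteristic polynomial factors as
  \<open>(z - s) (z\<^sup>2 - \<sigma> z + s\<^sup>2) (z\<^sup>2 - \<tau> z + s\<^sup>2)\<close> with \<open>\<sigma> + \<tau> = p - 2 s\<close> and \<open>\<sigma> \<tau> = q\<^sup>2 - 2 p s\<close>: the quartic
  factor is invariant under \<open>z \<mapsto> s\<^sup>2 / z\<close>, hence its roots come in two pairs with product \<open>s\<^sup>2\<close>.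
\<close>
lemma corner_seq_annihilated:
  assumes u: "corner_seq p q r s u"
    and pairs: "a + b = \<sigma>" "a * b = s^2" "c + d = \<tau>" "c * d = s^2"
    and sum: "\<sigma> + \<tau> = p - 2 * s" "\<sigma> * \<tau> = q^2 - 2 * p * s"
  shows "fold shift_diff [a, b, c, d, s] u n = 0"
proof -
  have "fold shift_diff [a, b, c, d, s] u n = shift_diff s (fold shift_diff [a, b, c, d] u) n"
    by simp
  also have "\<dots> = 0"
    unfolding shift_diff_def[of s] shift_diff_two_pairs(1)[OF pairs sum]
    using u unfolding corner_seq_def by (simp add: algebra_simps eval_nat_numeral)
  finally show ?thesis .
qed

text \<open>
  This identifies the polynomial \<open>N_fun\<close>: up to the factor 8 and the root \<open>\<mu> = (p - 2 s + x + z) / 4\<close>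
  it is the numerator of the Lagrange coefficient of \<open>\<mu>\<close>, with \<open>q\<^sup>2\<close> and \<open>z\<^sup>2\<close> reduced by the relations
  that define \<open>x\<close> and \<open>z\<close>.
\<close>
lemma N_fun_residue:
  fixes u :: "nat \<Rightarrow> complex"
  assumes u: "corner_seq p q r s u"
    and x: "x^2 = (p + 2 * s)^2 - 4 * q^2"
    and z: "z^2 = 2 * (p - 2 * s) * (p + 2 * s + x) - 4 * q^2"
    and cd: "c + d = (p - 2 * s - x) / 2" "c * d = s^2"
  shows "N_fun p q r s x z = 8 * ((p - 2 * s + x + z) / 4) *
     fold shift_diff [(p - 2 * s + x - z) / 4, s, c, d] u 0"
proof -
  define b where "b = (p - 2 * s + x - z) / 4"
  have L: "fold shift_diff [b, s, c, d] u 0 =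
     (u 4 - (b + s) * u 3 + b * s * u 2) - (p - 2 * s - x) / 2 * (u 3 - (b + s) * u 2 + b * s * u 1)
     + s^2 * (u 2 - (b + s) * u 1 + b * s * u 0)"
    by (simp add: shift_diff_pair[OF cd] shift_diff_pair[of b s, OF refl refl])
       (simp add: eval_nat_numeral)
  have b4: "4 * b = p - 2 * s + x - z"
    by (simp add: b_def)
  \<comment> \<open>The identity contains \<open>q\<close> only through its square, which becomes the variable \<open>Q\<close>.\<close>
  have ring: "2*s^4*(2*s + 3*p + x + z)
     + p*s^2*(4*Q - 2*s*(p - x) - (p + x)*(2*p + z))
     - 2*s*Q*(4*Q - 2*p^2 - (p - 2*s)*(2*x + z) - x*z)
     + r*(4*Q^2 - Q*(p + x)*(2*p + z) + 2*s*Q*(p - 2*s + 3*x + 2*z)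
          - 2*s^2*p*(p + x + z) - 2*s^3*(p - 2*s - x + z))
     + (Q - p*r)*(2*s^2*(2*s + 3*p + x) + 2*Q*(3*p - 4*s + x + z)
          - (s*(p - x) + p*(p + x))*(2*p + z)) = 8 * ((p - 2 * s + x + z) / 4) *
     (u4 - (b + s) * u3 + b * s * u2 - (p - 2 * s - x) / 2 * (u3 - (b + s) * u2 + b * s * r)
     + s^2 * (u2 - (b + s) * r + b * s))"
    if "u2 = p * r - Q"
      "u3 = p * u2 - p * s^2 - Q * (r - 2 * s)"
      "u4 = p * u3 - p * s^2 * r + s^4 - Q * (u2 - 2 * s * r + 2 * s^2)"
      "x^2 = (p + 2 * s)^2 - 4 * Q" "z^2 = 2 * (p - 2 * s) * (p + 2 * s + x) - 4 * Q"
    for Q u2 u3 u4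
    using that b4 by Groebner_Basis.algebra
  show ?thesis
    unfolding b_def[symmetric] L
    using ring[OF _ _ _ x z, of "u 2" "u 3" "u 4"] u
    unfolding N_fun_def corner_seq_def by simp
qed

text \<open>
  Here \<open>a\<close> is the root under consideration, \<open>b = s\<^sup>2 / a\<close> its partner, and \<open>c\<close>, \<open>d\<close> form the other pair.
  The denominator of \<open>K_fun\<close> is the product of the root distances in disguise: \<open>a - b = z / 2\<close> and
  \<open>(a - c) (a - d) = a\<^sup>2 - \<tau> a + s\<^sup>2 = (\<sigma> - \<tau>) a = x a\<close>, and \<open>(2 x + z)\<^sup>2 - y\<^sup>2 = 16 x a\<close>.  The exceptional
  values of \<open>q\<^sup>2\<close> are exactly those for which one of these distances can vanish.
\<close>
lemma mu_root_coefficient: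
  fixes u :: "nat \<Rightarrow> complex"
  assumes u: "corner_seq p q r s u"
    and ne: "q \<noteq> 0" "s \<noteq> 0" "q^2 \<noteq> 4 * s * (p - 2 * s)" "q^2 \<noteq> (p + 2 * s)^2 / 4"
    and x: "x^2 = (p + 2 * s)^2 - 4 * q^2"
    and z: "z^2 = 2 * (p - 2 * s) * (p + 2 * s + x) - 4 * q^2"
    and y: "y^2 = 2 * (p - 2 * s) * (p + 2 * s - x) - 4 * q^2"
    and a: "a = (p - 2 * s + x + z) / 4" and b: "b = (p - 2 * s + x - z) / 4"
    and cd: "c + d = (p - 2 * s - x) / 2" "c * d = s^2"
  shows "a \<notin> {b, s, c, d}"
    and "K_fun p q r s x y z * (\<Prod>w\<leftarrow>[b, s, c, d]. a - w) = fold shift_diff [b, s, c, d] u 0"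
proof -
  have ab: "a * b = s^2"
    using x z a b by Groebner_Basis.algebra
  have acd: "(a - c) * (a - d) = x * a"
    using x z a cd by Groebner_Basis.algebra
  have den: "(2 * x + z)^2 - y^2 = 16 * (x * a)"
    using x y z a by Groebner_Basis.algebra
  \<comment> \<open>The value \<open>x = 6 s - p\<close> is where \<open>s\<close> becomes a root of the quadratic factor of the pair \<open>a, b\<close>.\<close>
  have x6: "x \<noteq> 6 * s - p"
  proof
    assume "x = 6 * s - p"
    then have "q^2 = 4 * s * (p - 2 * s)" using x by Groebner_Basis.algebra
    then show False using ne by simp
  qed
  have x0: "x \<noteq> 0"
    using x ne(4) by auto
  have z0: "z \<noteq> 0"
  proof
    assume "z = 0"
    then have "(p + 2 * s + x) * (x - (6 * s - p)) = 0"
      using x z by Groebner_Basis.algebra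
    then have "p + 2 * s + x = 0"
      using x6 by simp
    then have "q^2 = 0"
      using x by Groebner_Basis.algebra
    then show False using ne(1) by simp
  qed
  have as: "a \<noteq> s"
  proof
    assume "a = s"
    have "x * s = (6 * s - p) * s"
      using ab a b \<open>a = s\<close> by Groebner_Basis.algebra
    then show False using x6 ne(2) by simp
  qed
  have a0: "a \<noteq> 0"
    using ab ne(2) by auto
  have abz: "a - b = z / 2"
    unfolding a b by (simp add: field_simps)
  show "a \<notin> {b, s, c, d}"
    using as abz z0 acd x0 a0 by auto
  have a4: "p - 2 * s + x + z = 4 * a" "p - 6 * s + x + z = 4 * (a - s)"
    unfolding a by (simp_all add: field_simps)
  have N: "N_fun p q r s x z = 8 * a * fold shift_diff [b, s, c, d] u 0"
    using N_fun_residue[OF u x z cd] unfolding a b .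
  have K: "K_fun p q r s x y z = fold shift_diff [b, s, c, d] u 0 / (z / 2 * (a - s) * (x * a))"
    unfolding K_fun_def N den a4 using z0 as x0 a0
    by (simp add: divide_simps)
  have prod: "(\<Prod>w\<leftarrow>[b, s, c, d]. a - w) = z / 2 * (a - s) * (x * a)"
    by (simp add: abz acd[symmetric])
  show "K_fun p q r s x y z * (\<Prod>w\<leftarrow>[b, s, c, d]. a - w) = fold shift_diff [b, s, c, d] u 0"
    unfolding K prod using z0 as x0 a0 by simp
qed

text \<open>
  The four sign choices for \<open>x = \<plusminus>\<alpha>\<close> and \<open>z\<close> in the previous lemma give the coefficients of the four
  roots of the quartic factor; the coefficient of \<open>s\<close> needs only the values of that factor.
\<close>
lemma mu_closed_form_generic:
  fixes u :: "nat \<Rightarrow> complex"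
  assumes u: "corner_seq p q r s u"
    and ne: "q \<noteq> 0" "s \<noteq> 0" "q^2 \<noteq> 4 * s * (p - 2 * s)" "q^2 \<noteq> (p + 2 * s)^2 / 4"
  shows "u n = (\<Sum>j = 1..5. kappa_mu_generic p q r s ! (j - 1) * mu p q s j ^ n)"
proof -
  define \<alpha> \<beta>1 \<beta>2 where "\<alpha> = alpha p q s" and "\<beta>1 = beta1 p q s" and "\<beta>2 = beta2 p q s"
  note defs = this
  define m1 m2 m3 m4 where
    "m1 = (p - 2 * s - \<alpha> - \<beta>1) / 4" and "m2 = (p - 2 * s - \<alpha> + \<beta>1) / 4"
    and "m3 = (p - 2 * s + \<alpha> - \<beta>2) / 4" and "m4 = (p - 2 * s + \<alpha> + \<beta>2) / 4"
  note m = this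
  have sq: "\<alpha>^2 = (p + 2 * s)^2 - 4 * q^2"
    "\<beta>1^2 = 2 * (p - 2 * s) * (p + 2 * s - \<alpha>) - 4 * q^2"
    "\<beta>2^2 = 2 * (p - 2 * s) * (p + 2 * s + \<alpha>) - 4 * q^2"
    by (simp_all add: defs alpha_def beta1_def beta2_def)
  have sums: "m1 + m2 = (p - 2 * s - \<alpha>) / 2" "m3 + m4 = (p - 2 * s + \<alpha>) / 2"
    by (simp_all add: m field_simps)
  have prods: "m1 * m2 = s^2" "m3 * m4 = s^2"
    subgoal using sq(1,2) m(1,2) by Groebner_Basis.algebra
    subgoal using sq(1,3) m(3,4) by Groebner_Basis.algebra
    done
  note coeff = mu_root_coefficient[OF u ne]
  have r1: "m1 \<notin> {m2, s, m3, m4}"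
     "K_fun p q r s (- \<alpha>) \<beta>2 (- \<beta>1) * (\<Prod>w\<leftarrow>[m2, s, m3, m4]. m1 - w) = fold shift_diff [m2, s, m3, m4] u 0"
    by (rule coeff[of "- \<alpha>" "- \<beta>1" \<beta>2]; (simp add: sq sums prods; fail | simp add: m; fail))+
  have r2: "m2 \<notin> {m1, s, m3, m4}"
     "K_fun p q r s (- \<alpha>) \<beta>2 \<beta>1 * (\<Prod>w\<leftarrow>[m1, s, m3, m4]. m2 - w) = fold shift_diff [m1, s, m3, m4] u 0"
    by (rule coeff[of "- \<alpha>" \<beta>1 \<beta>2]; (simp add: sq sums prods; fail | simp add: m; fail))+
  have r3: "m3 \<notin> {m4, s, m1, m2}"
     "K_fun p q r s \<alpha> \<beta>1 (- \<beta>2) * (\<Prod>w\<leftarrow>[m4, s, m1, m2]. m3 - w) = fold shift_diff [m4, s, m1, m2] u 0"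
    by (rule coeff[of \<alpha> "- \<beta>2" \<beta>1]; (simp add: sq sums prods; fail | simp add: m; fail))+
  have r4: "m4 \<notin> {m3, s, m1, m2}"
     "K_fun p q r s \<alpha> \<beta>1 \<beta>2 * (\<Prod>w\<leftarrow>[m3, s, m1, m2]. m4 - w) = fold shift_diff [m3, s, m1, m2] u 0"
    by (rule coeff[of \<alpha> \<beta>2 \<beta>1]; (simp add: sq sums prods; fail | simp add: m; fail))+
  have tau: "(p - 2 * s - \<alpha>) / 2 + (p - 2 * s + \<alpha>) / 2 = p - 2 * s"
    "(p - 2 * s - \<alpha>) / 2 * ((p - 2 * s + \<alpha>) / 2) = q^2 - 2 * p * s"
    subgoal by (simp add: field_simps)
    subgoal using sq(1) by (simp add: field_simps power2_eq_square)
    done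
  have annihilated: "fold shift_diff [m1, m2, m3, m4, s] u n = 0" for n
    by (rule corner_seq_annihilated[OF u sums(1) prods(1) sums(2) prods(2) tau])
  have "distinct [m1, m2, m3, m4, s]"
    using r1(1) r2(1) r3(1) r4(1) by auto
  then obtain c where c: "\<And>n. u n = (\<Sum>z\<leftarrow>[m1, m2, m3, m4, s]. c z * z ^ n)"
    and c_eq: "\<And>z ws. mset (z # ws) = mset [m1, m2, m3, m4, s] \<Longrightarrow>
       c z * (\<Prod>w\<leftarrow>ws. z - w) = fold shift_diff ws u 0"
    using lagrange_closed_form[of "[m1, m2, m3, m4, s]" u] annihilated by blast
  have coef: "c z = k"
    if "mset (z # ws) = mset [m1, m2, m3, m4, s]" "z \<notin> set ws"
      "k * (\<Prod>w\<leftarrow>ws. z - w) = fold shift_diff ws u 0" for z k ws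
  proof -
    have "(\<Prod>w\<leftarrow>ws. z - w) \<noteq> 0"
      using that(2) by auto
    then show ?thesis
      using c_eq[OF that(1)] that(3) by (metis mult_right_cancel)
  qed
  have c1: "c m1 = K_fun p q r s (- \<alpha>) \<beta>2 (- \<beta>1)"
    by (rule coef[OF _ _ r1(2)]) (use r1(1) in auto)
  have c2: "c m2 = K_fun p q r s (- \<alpha>) \<beta>2 \<beta>1"
    by (rule coef[OF _ _ r2(2)]) (use r2(1) in auto)
  have c3: "c m3 = K_fun p q r s \<alpha> \<beta>1 (- \<beta>2)"
    by (rule coef[OF _ _ r3(2)]) (use r3(1) in auto)
  have c4: "c m4 = K_fun p q r s \<alpha> \<beta>1 \<beta>2"
    by (rule coef[OF _ _ r4(2)]) (use r4(1) in auto)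
  have c5: "c s = 2 * s * (r + s - p) / (q^2 - 4 * s * (p - 2 * s))"
  proof -
    note quartic = shift_diff_two_pairs[OF sums(1) prods(1) sums(2) prods(2) tau]
    have "(\<Prod>w\<leftarrow>[m1, m2, m3, m4]. s - w) = s^2 * (q^2 - 4 * s * (p - 2 * s))"
      using quartic(2)[of s] by (simp add: algebra_simps eval_nat_numeral)
    moreover have "fold shift_diff [m1, m2, m3, m4] u 0 = 2 * s^3 * (r + s - p)"
      unfolding quartic(1) add_0 using corner_seq_values[OF u] by Groebner_Basis.algebra
    moreover have "mset (s # [m1, m2, m3, m4]) = mset [m1, m2, m3, m4, s]"
      by simp
    ultimately have "c s * (s^2 * (q^2 - 4 * s * (p - 2 * s))) = 2 * s^3 * (r + s - p)"
      using c_eq by metis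
    then have "s^2 * (c s * (q^2 - 4 * s * (p - 2 * s))) = s^2 * (2 * s * (r + s - p))"
      by Groebner_Basis.algebra
    then show ?thesis
      using ne(2,3) by (simp add: eq_divide_eq)
  qed
  have five: "{1..5::nat} = {1, 2, 3, 4, 5}" by auto
  show ?thesis
    unfolding c[of n] kappa_mu_generic_def mu_def five
    by (simp add: Let_def c1 c2 c3 c4 c5 defs[symmetric] m[symmetric])
qed

text \<open>
  The characteristic polynomial is \<open>(z\<^sup>2 - s\<^sup>2) (z\<^sup>2 - p z + s\<^sup>2)\<close>, and \<open>p\<^sup>2 \<noteq> 4 s\<^sup>2\<close> makes its roots simple.
\<close>
lemma nu_closed_form_generic:
  fixes u :: "nat \<Rightarrow> complex"
  assumes u: "corner_seq p 0 r s u" and s: "s \<noteq> 0" and p: "p^2 \<noteq> 4 * s^2"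
  shows "u n = (\<Sum>j = 1..4. kappa_nu p r s n j * nu p s j ^ n)"
proof -
  define w where "w = csqrt (p^2 - 4 * s^2)"
  define a b where "a = (p - w) / 2" and "b = (p + w) / 2"
  have w2: "w^2 = p^2 - 4 * s^2"
    by (simp add: w_def)
  have w0: "w \<noteq> 0"
    using w2 p by auto
  have ab: "a + b = p" "a * b = s^2" "a - b = - w"
    using w2 by (simp_all add: a_def b_def field_simps power2_eq_square)
  have ne: "a \<noteq> 0" "b \<noteq> 0"
    using ab(2) s by auto
  have ps: "p + 2 * s \<noteq> 0" "p - 2 * s \<noteq> 0"
  proof -
    have "(p + 2 * s) * (p - 2 * s) \<noteq> 0"
      using p by (simp add: algebra_simps power2_eq_square)
    then show "p + 2 * s \<noteq> 0" "p - 2 * s \<noteq> 0"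
      by auto
  qed
  have val_s: "(s - a) * (s - b) = s * (2 * s - p)" "(- s - a) * (- s - b) = s * (2 * s + p)"
    by (simp_all add: ab(1)[symmetric] algebra_simps) (simp_all add: ab(2) power2_eq_square)
  have "(s - a) * (s - b) \<noteq> 0" "(- s - a) * (- s - b) \<noteq> 0"
    unfolding val_s using s ps by (auto simp: add.commute)
  then have dist: "distinct [- s, s, a, b]"
    using s w0 ab(3) by auto
  have annihilated: "fold shift_diff [- s, s, a, b] u n = 0" for n
    using corner_seq_q0[OF u, of n]
    by (simp add: shift_diff_pair[OF ab(1,2)] shift_diff_pair[of "- s" s, OF refl refl])
       (simp add: algebra_simps eval_nat_numeral)
  obtain c where c: "\<And>n. u n = (\<Sum>z\<leftarrow>[- s, s, a, b]. c z * z ^ n)"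
    and c_eq: "\<And>z ws. mset (z # ws) = mset [- s, s, a, b] \<Longrightarrow>
       c z * (\<Prod>w\<leftarrow>ws. z - w) = fold shift_diff ws u 0"
    using lagrange_closed_form[OF dist annihilated] by blast
  have val: "u 0 = 1" "u 1 = r" "u 2 = p * r" "u 3 = p * (p * r) - p * s^2"
    using corner_seq_values[OF u] by simp_all
  have c1: "c (- s) = K6 p r s 1"
  proof -
    have "c (- s) * (- s - s) * ((- s - a) * (- s - b)) = fold shift_diff [s, a, b] u 0"
      using c_eq[of "- s" "[s, a, b]"] by (simp add: mult.assoc)
    also have "\<dots> = u 3 - (p + s) * u 2 + (s^2 + p * s) * u 1 - s^3 * u 0"
      by (simp add: shift_diff_pair[OF ab(1,2)] shift_diff_def) (simp add: algebra_simps eval_nat_numeral)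
    finally have "s^2 * (2 * (c (- s) * (p + 2 * s))) = s^2 * (p - r + s)"
      unfolding val_s val by Groebner_Basis.algebra
    then have num: "p - r + s = 2 * (c (- s) * (p + 2 * s))"
      using s by simp
    have "K6 p r s 1 = (p - r + s) / (2 * (p + 2 * s))"
      by (simp add: K6_def)
    also have "\<dots> = c (- s)"
      unfolding num using ps by (simp only: mult_eq_0_iff divide_eq_eq) (simp add: algebra_simps)
    finally show ?thesis ..
  qed
  have c2: "c s = K6 p r s (- 1)"
  proof -
    have "c s * (s + s) * ((s - a) * (s - b)) = fold shift_diff [- s, a, b] u 0"
      using c_eq[of s "[- s, a, b]"] by (simp add: mult.assoc add_mset_commute)
    also have "\<dots> = u 3 - (p - s) * u 2 + (s^2 - p * s) * u 1 + s^3 * u 0"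
      by (simp add: shift_diff_pair[OF ab(1,2)] shift_diff_def) (simp add: algebra_simps eval_nat_numeral)
    finally have "s^2 * (2 * (c s * (p - 2 * s))) = s^2 * (p - r - s)"
      unfolding val_s val by Groebner_Basis.algebra
    then have num: "p - r - s = 2 * (c s * (p - 2 * s))"
      using s by simp
    have "K6 p r s (- 1) = (p - r - s) / (2 * (p - 2 * s))"
      by (simp add: K6_def)
    also have "\<dots> = c s"
      unfolding num using ps by (simp only: mult_eq_0_iff divide_eq_eq) (simp add: algebra_simps)
    finally show ?thesis ..
  qed
  \<comment> \<open>One computation for both roots: \<open>i = 1\<close> and \<open>i = - 1\<close> select the sign of the square root.\<close>
  have K7: "k = K7 p r s i"
    if k: "k * ((x + s) * ((x - s) * (x - y))) = fold shift_diff [- s, s, y] u 0"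
      and i: "2 * x = p - i * w" "2 * y = p + i * w" "i^2 = 1" and x: "x \<noteq> 0" for k x y i
  proof -
    have "fold shift_diff [- s, s, y] u 0 = u 3 - y * u 2 - s^2 * u 1 + s^2 * y * u 0"
      by (simp add: shift_diff_def) (simp add: algebra_simps eval_nat_numeral)
    moreover have "(x + s) * ((x - s) * (x - y)) = w^2 * x"
      using i w2 by Groebner_Basis.algebra
    ultimately have M: "p * (p * r) - p * s^2 - y * (p * r) - s^2 * r + s^2 * y = k * (w^2 * x)"
      using k unfolding val by simp
    have den: "(p^2 - 4 * s^2) * (p^2 - 2 * s^2 - i * p * w) = 2 * x * (w^2 * x)"
      using i w2 by Groebner_Basis.algebra
    have num: "p^3 * r - p^2 * s^2 - 3 * p * r * s^2 + 2 * s^4 + i * (p * s^2 + r * s^2 - p^2 * r) * w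
       = 2 * x * (p * (p * r) - p * s^2 - y * (p * r) - s^2 * r + s^2 * y)"
      using i w2 by Groebner_Basis.algebra
    show ?thesis
      unfolding K7_def w_def[symmetric] den num M using x w0 by simp
  qed
  have c3: "c a = K7 p r s 1"
    by (rule K7[of _ a b]) (use c_eq[of a "[- s, s, b]"] ne in \<open>simp_all add: a_def b_def add_mset_commute\<close>)
  have c4: "c b = K7 p r s (- 1)"
    by (rule K7[of _ b a]) (use c_eq[of b "[- s, s, a]"] ne in \<open>simp_all add: a_def b_def add_mset_commute\<close>)
  have four: "{1..4::nat} = {1, 2, 3, 4}" by auto
  show ?thesis
    using p unfolding c[of n] kappa_nu_def nu_def four
    by (simp add: c1 c2 c3 c4 w_def[symmetric] a_def[symmetric] b_def[symmetric])
qed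

lemma xi_closed_form_generic:
  fixes u :: "nat \<Rightarrow> complex"
  assumes u: "corner_seq p q r 0 u" and p: "p^2 \<noteq> 4 * q^2"
  shows "u n = (\<Sum>j = 1..2. kappa_xi p q r n j * xi p q j ^ n)"
proof -
  define w where "w = csqrt (p^2 - 4 * q^2)"
  define a b where "a = (p - w) / 2" and "b = (p + w) / 2"
  have w2: "w^2 = p^2 - 4 * q^2"
    by (simp add: w_def)
  have w0: "w \<noteq> 0"
    using w2 p by auto
  have ab: "a + b = p" "a * b = q^2" "a - b = - w" "b - a = w"
    using w2 by (simp_all add: a_def b_def field_simps power2_eq_square)
  have dist: "distinct [a, b]"
    using w0 ab(3) by auto
  have annihilated: "fold shift_diff [a, b] u n = 0" for n
    using corner_seq_s0[OF u, of n] by (simp add: shift_diff_pair[OF ab(1,2)])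
  obtain c where c: "\<And>n. u n = (\<Sum>z\<leftarrow>[a, b]. c z * z ^ n)"
    and c_eq: "\<And>z ws. mset (z # ws) = mset [a, b] \<Longrightarrow>
       c z * (\<Prod>w\<leftarrow>ws. z - w) = fold shift_diff ws u 0"
    using lagrange_closed_form[OF dist annihilated] by blast
  note val = corner_seq_values[OF u]
  have "c a * (a - b) = r - b" "c b * (b - a) = r - a"
    using c_eq[of a "[b]"] c_eq[of b "[a]"] val(1,2) by (simp_all add: shift_diff_def add_mset_commute)
  then have c12: "c a = (p - 2 * r + w) / (2 * w)" "c b = (2 * r - p + w) / (2 * w)"
    unfolding ab using w0 by (simp_all add: a_def b_def field_simps)
  have two: "{1..2::nat} = {1, 2}" by auto
  show ?thesis
    using p unfolding c[of n] kappa_xi_def xi_def two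
    by (simp add: c12 w_def[symmetric] a_def[symmetric] b_def[symmetric])
qed

section \<open>Closed forms for repeated characteristic roots\<close>

text \<open>
  With repeated roots the coefficients are not quotients of Lagrange type, so the formulas are compared
  with the recurrence and its initial values directly.
\<close>
lemma corner_seq_quintuple_root:
  fixes s :: "'a :: field_char_0"
  assumes "s \<noteq> 0" "p = 6 * s" "q^2 = 16 * s^2"
  shows "corner_seq p q r s (\<lambda>n. (1 + of_nat n * ((r + 8 * s) / (6 * s))
     + of_nat n ^ 2 * ((5 * r - 7 * s) / (12 * s)) + of_nat n ^ 3 * ((r - 4 * s) / (3 * s))
     + of_nat n ^ 4 * ((r - 5 * s) / (12 * s))) * s ^ n)"
  unfolding corner_seq_def assms(2,3)
proof (intro conjI allI)
  fix n
  define c1 c2 c3 c4 where "c1 = (r + 8 * s) / (6 * s)" and "c2 = (5 * r - 7 * s) / (12 * s)"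
    and "c3 = (r - 4 * s) / (3 * s)" and "c4 = (r - 5 * s) / (12 * s)"
  let ?u = "\<lambda>n. (1 + of_nat n * c1 + of_nat n ^ 2 * c2 + of_nat n ^ 3 * c3 + of_nat n ^ 4 * c4) * s ^ n"
  show "?u (n + 5) = (6 * s - s) * ?u (n + 4) + (6 * s * s - 16 * s^2) * (?u (n + 3) - s * ?u (n + 2))
     + s^3 * (s - 6 * s) * ?u (n + 1) + s^5 * ?u n"
    unfolding power_add of_nat_add of_nat_numeral of_nat_1 by Groebner_Basis.algebra
qed (use assms(1) in \<open>simp_all add: field_simps eval_nat_numeral\<close>)

text \<open>
  The parameter \<open>t = p / 2\<close> is \<open>s\<close> or \<open>- s\<close>; for \<open>q = 0\<close> the sequence depends on
  \<open>s\<^sup>2\<close> only, so both signs share one formula.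
\<close>
lemma corner_seq_nu_triple_root:
  fixes t :: "'a :: field_char_0"
  assumes "t \<noteq> 0" "p = 2 * t" "s = t \<or> s = - t"
  shows "corner_seq p 0 r s (\<lambda>n. (3 * t - r) / (8 * t) * (- t) ^ n
     + ((r + 5 * t) / (8 * t) + of_nat n * (r / (2 * t)) + of_nat n ^ 2 * ((r - t) / (4 * t))) * t ^ n)"
  unfolding corner_seq_def assms(2)
proof (intro conjI allI)
  fix n
  define c0 c1 c2 c3 where "c0 = (3 * t - r) / (8 * t)" and "c1 = (r + 5 * t) / (8 * t)"
    and "c2 = r / (2 * t)" and "c3 = (r - t) / (4 * t)"
  let ?u = "\<lambda>n. c0 * (- t) ^ n + (c1 + of_nat n * c2 + of_nat n ^ 2 * c3) * t ^ n"
  show "?u (n + 5) = (2 * t - s) * ?u (n + 4) + (2 * t * s - 0^2) * (?u (n + 3) - s * ?u (n + 2))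
     + s^3 * (s - 2 * t) * ?u (n + 1) + s^5 * ?u n"
    using assms(3)
  proof
    assume s: "s = t"
    show ?thesis
      unfolding s by (simp add: algebra_simps eval_nat_numeral)
  next
    assume s: "s = - t"
    show ?thesis
      unfolding s by (simp add: algebra_simps eval_nat_numeral)
  qed
qed (use assms(1,3) in \<open>auto simp: field_simps eval_nat_numeral\<close>)

lemma corner_seq_xi_double_root:
  fixes p :: "'a :: field_char_0"
  assumes "p \<noteq> 0" "q^2 = p^2 / 4"
  shows "corner_seq p q r 0 (\<lambda>n. (1 + of_nat n * ((2 * r - p) / p)) * (p / 2) ^ n)"
  unfolding corner_seq_def assms(2)
proof (intro conjI allI)
  fix n
  define c where "c = (2 * r - p) / p"
  let ?u = "\<lambda>n. (1 + of_nat n * c) * (p / 2) ^ n"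
  show "?u (n + 5) = (p - 0) * ?u (n + 4) + (p * 0 - p^2 / 4) * (?u (n + 3) - 0 * ?u (n + 2))
     + 0^3 * (0 - p) * ?u (n + 1) + 0^5 * ?u n"
    unfolding power_add of_nat_add of_nat_numeral of_nat_1 by (simp add: field_simps eval_nat_numeral)
qed (use assms(1) in \<open>simp_all add: field_simps eval_nat_numeral\<close>)

text \<open>
  The two simple roots are \<open>a\<close> and \<open>s\<^sup>2 / a\<close>.  In terms of \<open>a\<close> and the ratio \<open>t = s / a\<close> everything is
  rational, and \<open>j\<close>, the inverse of the common denominator, turns the comparison into polynomial
  identities modulo a single relation.
\<close>
lemma corner_seq_triple_root:
  fixes a t :: "'a :: field_char_0"
  assumes j: "a * (t - 1)^4 * j = 1"
    and p: "p = a * (t^2 + 4 * t + 1)" and s: "s = a * t" and q: "q^2 = 4 * a^2 * t * (t + 1)^2"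
  shows "corner_seq p q r s (\<lambda>n.
     j * (a * (t^4 + 8 * t^2 + 1) - r * (t^2 + 1)
       + 2 * of_nat n * ((t - 1)^2 * (a * (t + 1)^2 - r))
       + of_nat n ^ 2 * ((t - 1)^2 * (a * (t^2 + 3 * t + 1) - r))) * s ^ n
     + j * (r - a * (t^2 + 4 * t)) * a ^ n
     + j * t^2 * (r - a * (4 * t + 1)) * (a * t^2) ^ n)"
  unfolding corner_seq_def q
proof (intro conjI allI)
  fix n
  let ?u = "\<lambda>n. j * (a * (t^4 + 8 * t^2 + 1) - r * (t^2 + 1)
       + 2 * of_nat n * ((t - 1)^2 * (a * (t + 1)^2 - r))
       + of_nat n ^ 2 * ((t - 1)^2 * (a * (t^2 + 3 * t + 1) - r))) * s ^ n
     + j * (r - a * (t^2 + 4 * t)) * a ^ n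
     + j * t^2 * (r - a * (4 * t + 1)) * (a * t^2) ^ n"
  show "?u (n + 5) = (p - s) * ?u (n + 4) + (p * s - 4 * a^2 * t * (t + 1)^2) * (?u (n + 3) - s * ?u (n + 2))
       + s^3 * (s - p) * ?u (n + 1) + s^5 * ?u n"
    unfolding power_add of_nat_add of_nat_numeral of_nat_1 p s power_mult_distrib
    by Groebner_Basis.algebra
qed (unfold p s of_nat_0 of_nat_1 of_nat_numeral power_mult_distrib power_0 power_one_right power_one
      zero_power2 mult_zero_left mult_zero_right add_0_left add_0_right mult_1_left mult_1_right,
     (use j in Groebner_Basis.algebra)+)

text \<open>
  The same parametrization: the double roots are \<open>a\<close> and \<open>s\<^sup>2 / a = a t\<^sup>2\<close>, and the simple root is
  \<open>s = a t\<close>.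
\<close>
lemma corner_seq_two_double_roots:
  fixes a t :: "'a :: field_char_0"
  assumes j: "a * (t - 1)^4 * (t + 1) * j = 1"
    and p: "p = 2 * a * (t^2 + t + 1)" and s: "s = a * t" and q: "q^2 = a^2 * (t + 1)^4"
  shows "corner_seq p q r s (\<lambda>n.
     j * (a * (t + 1) * (4 * t^2 + 1) - 2 * r * t
       + of_nat n * ((t - 1) * (a * (2 * t^2 + 2 * t + 1) - r))) * a ^ n
     + j * t^2 * (a * (t + 1) * (t^2 + 4) - 2 * r
       + of_nat n * ((t - 1) * (r - a * (t^2 + 2 * t + 2)))) * (a * t^2) ^ n
     + 2 * j * t * (t + 1) * (r - a * (2 * t^2 + t + 2)) * s ^ n)"
  unfolding corner_seq_def q
proof (intro conjI allI)
  fix n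
  let ?u = "\<lambda>n. j * (a * (t + 1) * (4 * t^2 + 1) - 2 * r * t
       + of_nat n * ((t - 1) * (a * (2 * t^2 + 2 * t + 1) - r))) * a ^ n
     + j * t^2 * (a * (t + 1) * (t^2 + 4) - 2 * r
       + of_nat n * ((t - 1) * (r - a * (t^2 + 2 * t + 2)))) * (a * t^2) ^ n
     + 2 * j * t * (t + 1) * (r - a * (2 * t^2 + t + 2)) * s ^ n"
  show "?u (n + 5) = (p - s) * ?u (n + 4) + (p * s - a^2 * (t + 1)^4) * (?u (n + 3) - s * ?u (n + 2))
       + s^3 * (s - p) * ?u (n + 1) + s^5 * ?u n"
    unfolding power_add of_nat_add of_nat_numeral of_nat_1 p s power_mult_distrib
    by Groebner_Basis.algebra
qed (unfold p s of_nat_0 of_nat_1 of_nat_numeral power_mult_distrib power_0 power_one_right power_one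
      zero_power2 mult_zero_left mult_zero_right add_0_left add_0_right mult_1_left mult_1_right,
     (use j in Groebner_Basis.algebra)+)

text \<open>
  The substitution \<open>t = s / a\<close> rationalizes the square root \<open>gam p s\<close> to \<open>a (t\<^sup>2 - 1)\<close>; after it,
  \<open>K1\<close>, \<open>K2\<close> and \<open>K3\<close> reduce to the coefficients of the rational form.
\<close>
lemma mu_closed_form_triple_root:
  fixes u :: "nat \<Rightarrow> complex"
  assumes u: "corner_seq p q r s u" and ne: "q \<noteq> 0" "s \<noteq> 0" "p \<noteq> 6 * s"
    and q: "q^2 = 4 * s * (p - 2 * s)"
  shows "u n = (K1 p r s + 2 * of_nat n * K2 p r s 2 + of_nat n ^ 2 * K2 p r s 1) * s ^ n
     + K3 p r s (gam p s) * ((p - 4 * s - gam p s) / 2) ^ n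
     + K3 p r s (- gam p s) * ((p - 4 * s + gam p s) / 2) ^ n"
proof -
  define z a b where "z = gam p s" and "a = (p - 4 * s - z) / 2" and "b = (p - 4 * s + z) / 2"
  \<comment> \<open>The square root \<open>z\<close> is the distance of the two roots \<open>a\<close> and \<open>b = s\<^sup>2 / a\<close>, hence rational in \<open>a\<close> and \<open>t\<close>.\<close>
  define t where "t = s / a"
  have z2: "z^2 = (p - 6 * s) * (p - 2 * s)"
    by (simp add: z_def gam_def)
  have "a * b = s^2"
    using z2 by (simp add: a_def b_def field_simps power2_eq_square)
  then have a0: "a \<noteq> 0" and s: "s = a * t" and b: "b = a * t^2"
    using ne(2) by (auto simp: t_def field_simps power2_eq_square)
  have "p = 4 * s + a + b" "z = b - a"
    by (simp_all add: a_def b_def field_simps)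
  then have p: "p = a * (t^2 + 4 * t + 1)" and z: "z = a * (t^2 - 1)"
    unfolding s b by Groebner_Basis.algebra+
  have p6: "p - 6 * s = a * (t - 1)^2" and p2: "p - 2 * s = a * (t + 1)^2"
    unfolding p s by Groebner_Basis.algebra+
  have t: "t \<noteq> 0" "t - 1 \<noteq> 0" "t + 1 \<noteq> 0"
    using ne p6 p2 s q by auto
  define j where "j = 1 / (a * (t - 1)^4)"
  have j: "a * (t - 1)^4 * j = 1"
    using a0 t by (simp add: j_def)
  have quot: "X / Y = j * W"
    if "X * (a * (t - 1)^4) = W * Y" "Y \<noteq> 0" for X Y W
    using that a0 t by (simp add: j_def frac_eq_eq)
  have k1: "K1 p r s = j * (a * (t^4 + 8 * t^2 + 1) - r * (t^2 + 1))"
    unfolding K1_def p6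
    by (rule quot[rotated], use a0 t in simp, unfold p s, Groebner_Basis.algebra)
  have k2: "K2 p r s i = j * ((t - 1)^2 * (p - r - i * s))" for i
    unfolding K2_def p6
    by (rule quot[rotated], use a0 t in simp, Groebner_Basis.algebra)
  have zm: "- z = a * (1 - t^2)"
    unfolding z by Groebner_Basis.algebra
  have z0: "z \<noteq> 0"
  proof -
    have "z = a * (t - 1) * (t + 1)" unfolding z by Groebner_Basis.algebra
    then show ?thesis using a0 t by simp
  qed
  have inner: "4 * s * (3 * s - z) + p * (p - 8 * s + z) = z * (2 * b)"
     "4 * s * (3 * s - - z) + p * (p - 8 * s + - z) = - z * (2 * a)"
    unfolding p s z b by Groebner_Basis.algebra+
  have k3: "K3 p r s z = j * (r - a * (t^2 + 4 * t))"
    "K3 p r s (- z) = j * (t^2 * (r - a * (4 * t + 1)))"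
    unfolding K3_def inner b p2
    subgoal by (rule quot[rotated], use z0 a0 t in simp, unfold p s z, Groebner_Basis.algebra)
    subgoal by (rule quot[rotated], use z0 a0 t in simp, unfold zm p s, Groebner_Basis.algebra)
    done
  have q': "q^2 = 4 * a^2 * t * (t + 1)^2"
    unfolding q p2 unfolding s by Groebner_Basis.algebra
  have i: "p - r - 2 * s = a * (t + 1)^2 - r" "p - r - 1 * s = a * (t^2 + 3 * t + 1) - r"
    unfolding p s by Groebner_Basis.algebra+
  show ?thesis
    unfolding corner_seq_unique[OF u corner_seq_triple_root[OF j p s q'], of n]
    unfolding z_def[symmetric] a_def[symmetric] b_def[symmetric] b k1 k2 k3 i
    by (simp add: algebra_simps)
qed

text \<open>
  Here \<open>del p s = 2 a (t\<^sup>2 - 1)\<close>, and the long polynomials \<open>N4\<close> and \<open>N5\<close> factor into powers of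
  \<open>a\<close> and \<open>t\<close>, one of \<open>t - 1\<close> and \<open>t + 1\<close>, and a short polynomial that is linear in \<open>r\<close>.
\<close>
lemma mu_closed_form_two_double_roots:
  fixes u :: "nat \<Rightarrow> complex"
  assumes u: "corner_seq p q r s u" and ne: "q \<noteq> 0" "s \<noteq> 0" "p \<noteq> 6 * s"
    and q: "q^2 = (p + 2 * s)^2 / 4"
  shows "u n = (K4 p r s (del p s) + of_nat n * K5 p r s (del p s)) * ((p - 2 * s - del p s) / 4) ^ n
     + (K4 p r s (- del p s) + of_nat n * K5 p r s (- del p s)) * ((p - 2 * s + del p s) / 4) ^ n
     + 8 * s * (r + s - p) / (p - 6 * s)^2 * s ^ n"
proof -
  define z a b where "z = del p s" and "a = (p - 2 * s - z) / 4" and "b = (p - 2 * s + z) / 4"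
  define t where "t = s / a"
  have z2: "z^2 = (p - 6 * s) * (p + 2 * s)"
    by (simp add: z_def del_def)
  have "a * b = s^2"
    using z2 by (simp add: a_def b_def field_simps power2_eq_square)
  then have a0: "a \<noteq> 0" and s: "s = a * t" and b: "b = a * t^2"
    using ne(2) by (auto simp: t_def field_simps power2_eq_square)
  have "p = 2 * s + 2 * (a + b)" "z = 2 * (b - a)"
    by (simp_all add: a_def b_def field_simps)
  then have p: "p = 2 * a * (t^2 + t + 1)" and z: "z = 2 * a * (t^2 - 1)"
    unfolding s b by Groebner_Basis.algebra+
  have p6: "p - 6 * s = 2 * a * (t - 1)^2" and p2: "p + 2 * s = 2 * a * (t + 1)^2"
    unfolding p s by Groebner_Basis.algebra+
  have t: "t \<noteq> 0" "t - 1 \<noteq> 0" "t + 1 \<noteq> 0"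
    using ne p6 p2 s q by auto
  define j where "j = 1 / (a * (t - 1)^4 * (t + 1))"
  have j: "a * (t - 1)^4 * (t + 1) * j = 1"
    using a0 t by (simp add: j_def)
  have q': "q^2 = a^2 * (t + 1)^4"
    unfolding q p2 by (simp add: power_mult_distrib)
  have z': "p - 2 * s - z = 4 * a" "p - 2 * s - - z = 4 * (a * t^2)"
      "p - 6 * s - z = 4 * a * (1 - t)" "p - 6 * s - - z = 4 * a * t * (t - 1)"
    unfolding p s z by Groebner_Basis.algebra+
  have zm: "- z = 2 * a * (1 - t^2)"
    unfolding z by Groebner_Basis.algebra
  have z0: "z \<noteq> 0"
  proof -
    have "z = 2 * a * (t - 1) * (t + 1)" unfolding z by Groebner_Basis.algebra
    then show ?thesis using a0 t by simp
  qed
  have N4: "N4 p r s z = 128 * a^5 * (t - 1) * (a * (t + 1) * (4 * t^2 + 1) - 2 * r * t)"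
    "N4 p r s (- z) = - 128 * a^5 * t^8 * (t - 1) * (a * (t + 1) * (t^2 + 4) - 2 * r)"
    unfolding N4_def p s z by Groebner_Basis.algebra+
  have N5: "N5 p r s z = 64 * a^4 * (t + 1) * (r - a * (2 * t^2 + 2 * t + 1))"
    "N5 p r s (- z) = 64 * a^4 * t^7 * (t + 1) * (r - a * (t^2 + 2 * t + 2))"
    unfolding N5_def p s z by Groebner_Basis.algebra+
  have quot: "X / Y = j * W"
    if "X * (a * (t - 1)^4 * (t + 1)) = W * Y" "Y \<noteq> 0" for X Y W
    using that a0 t by (simp add: j_def frac_eq_eq)
  have k4: "K4 p r s z = j * (a * (t + 1) * (4 * t^2 + 1) - 2 * r * t)"
    "K4 p r s (- z) = j * (t^2 * (a * (t + 1) * (t^2 + 4) - 2 * r))"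
    unfolding K4_def N4 unfolding z' unfolding p6
    subgoal by (rule quot[rotated], use z0 a0 t in simp, unfold z, Groebner_Basis.algebra)
    subgoal by (rule quot[rotated], use z0 a0 t in simp, unfold zm, Groebner_Basis.algebra)
    done
  have k5: "K5 p r s z = j * ((t - 1) * (a * (2 * t^2 + 2 * t + 1) - r))"
    "K5 p r s (- z) = j * (t^2 * ((t - 1) * (r - a * (t^2 + 2 * t + 2))))"
    unfolding K5_def N5 z'
    subgoal by (rule quot[rotated], use z0 a0 t in simp, unfold z, Groebner_Basis.algebra)
    subgoal by (rule quot[rotated], use z0 a0 t in simp, unfold zm, Groebner_Basis.algebra)
    done
  have k6: "8 * s * (r + s - p) / (p - 6 * s)^2 = j * (2 * t * (t + 1) * (r - a * (2 * t^2 + t + 2)))"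
    unfolding p6 by (rule quot[rotated], use a0 t in simp, unfold p s, Groebner_Basis.algebra)
  show ?thesis
    unfolding corner_seq_unique[OF u corner_seq_two_double_roots[OF j p s q'], of n]
    unfolding z_def[symmetric] a_def[symmetric] b_def[symmetric] b k4 k5 k6
    by (simp add: algebra_simps)
qed

section \<open>The listed roots and coefficients in all cases\<close>

lemma csqrt_4_mult: "csqrt (4 * z) = 2 * csqrt z"
proof (rule csqrt_unique)
  show "(2 * csqrt z)^2 = 4 * z"
    by (simp add: power_mult_distrib)
  show "0 < Re (2 * csqrt z) \<or> Re (2 * csqrt z) = 0 \<and> 0 \<le> Im (2 * csqrt z)"
    using csqrt_principal[of z] by auto
qed

text \<open>
  Over the reals, \<open>alpha\<close> is \<open>\<bar>p - 6 s\<bar>\<close> here, so the sign of \<open>p - 6 s\<close> decides which of the two pairs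
  of roots collapses to \<open>s\<close>.
\<close>
lemma mu_exceptional_small:
  fixes p q s :: real
  assumes q: "q^2 = 4 * s * (p - 2 * s)" and p: "p < 6 * s"
  defines "P \<equiv> complex_of_real p" and "Q \<equiv> complex_of_real q" and "S \<equiv> complex_of_real s"
  shows "mu P Q S 1 = (P - 4 * S - gam P S) / 2" "mu P Q S 2 = (P - 4 * S + gam P S) / 2"
    "mu P Q S 3 = S" "mu P Q S 4 = S" "mu P Q S 5 = S"
proof -
  have Q2: "Q^2 = 4 * S * (P - 2 * S)"
    using arg_cong[OF q, of complex_of_real] by (simp add: P_def Q_def S_def)
  have "alpha P Q S = csqrt ((6 * S - P)^2)"
    unfolding alpha_def Q2 by (rule arg_cong[where f = csqrt]) Groebner_Basis.algebra
  also have "\<dots> = 6 * S - P"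
    using p by (intro csqrt_square) (simp add: P_def S_def)
  finally have alpha: "alpha P Q S = 6 * S - P" .
  have "beta1 P Q S = csqrt (4 * ((P - 6 * S) * (P - 2 * S)))"
    unfolding beta1_def alpha Q2 by (rule arg_cong[where f = csqrt]) Groebner_Basis.algebra
  then have beta1: "beta1 P Q S = 2 * gam P S"
    by (simp add: csqrt_4_mult gam_def)
  have "beta2 P Q S = csqrt 0"
    unfolding beta2_def alpha Q2 by (rule arg_cong[where f = csqrt]) Groebner_Basis.algebra
  then have beta2: "beta2 P Q S = 0"
    by simp
  show "mu P Q S 1 = (P - 4 * S - gam P S) / 2" "mu P Q S 2 = (P - 4 * S + gam P S) / 2"
    "mu P Q S 3 = S" "mu P Q S 4 = S" "mu P Q S 5 = S"
    by (simp_all add: mu_def alpha beta1 beta2 field_simps)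
qed

lemma mu_exceptional_large:
  fixes p q s :: real
  assumes q: "q^2 = 4 * s * (p - 2 * s)" and p: "p > 6 * s"
  defines "P \<equiv> complex_of_real p" and "Q \<equiv> complex_of_real q" and "S \<equiv> complex_of_real s"
  shows "mu P Q S 3 = (P - 4 * S - gam P S) / 2" "mu P Q S 4 = (P - 4 * S + gam P S) / 2"
    "mu P Q S 1 = S" "mu P Q S 2 = S" "mu P Q S 5 = S"
proof -
  have Q2: "Q^2 = 4 * S * (P - 2 * S)"
    using arg_cong[OF q, of complex_of_real] by (simp add: P_def Q_def S_def)
  have "alpha P Q S = csqrt ((P - 6 * S)^2)"
    unfolding alpha_def Q2 by (rule arg_cong[where f = csqrt]) Groebner_Basis.algebra
  also have "\<dots> = P - 6 * S"
    using p by (intro csqrt_square) (simp add: P_def S_def)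
  finally have alpha: "alpha P Q S = P - 6 * S" .
  have "beta2 P Q S = csqrt (4 * ((P - 6 * S) * (P - 2 * S)))"
    unfolding beta2_def alpha Q2 by (rule arg_cong[where f = csqrt]) Groebner_Basis.algebra
  then have beta2: "beta2 P Q S = 2 * gam P S"
    by (simp add: csqrt_4_mult gam_def)
  have "beta1 P Q S = csqrt 0"
    unfolding beta1_def alpha Q2 by (rule arg_cong[where f = csqrt]) Groebner_Basis.algebra
  then have beta1: "beta1 P Q S = 0"
    by simp
  show "mu P Q S 3 = (P - 4 * S - gam P S) / 2" "mu P Q S 4 = (P - 4 * S + gam P S) / 2"
    "mu P Q S 1 = S" "mu P Q S 2 = S" "mu P Q S 5 = S"
    by (simp_all add: mu_def alpha beta1 beta2 field_simps)
qed

lemma mu_alpha_zero: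
  assumes q: "q^2 = (p + 2 * s)^2 / 4"
  shows "mu p q s 1 = (p - 2 * s - del p s) / 4" "mu p q s 2 = (p - 2 * s + del p s) / 4"
    "mu p q s 3 = (p - 2 * s - del p s) / 4" "mu p q s 4 = (p - 2 * s + del p s) / 4"
    "mu p q s 5 = s"
proof -
  have alpha: "alpha p q s = 0"
    unfolding alpha_def q by simp
  have beta: "beta1 p q s = del p s" "beta2 p q s = del p s"
    unfolding beta1_def beta2_def alpha q del_def
    by (rule arg_cong[where f = csqrt], Groebner_Basis.algebra)+
  show "mu p q s 1 = (p - 2 * s - del p s) / 4" "mu p q s 2 = (p - 2 * s + del p s) / 4"
    "mu p q s 3 = (p - 2 * s - del p s) / 4" "mu p q s 4 = (p - 2 * s + del p s) / 4"
    "mu p q s 5 = s"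
    by (simp_all add: mu_def alpha beta)
qed

lemma mu_closed_form:
  fixes p q r s :: real
  defines "P \<equiv> complex_of_real p" and "Q \<equiv> complex_of_real q"
    and "R \<equiv> complex_of_real r" and "S \<equiv> complex_of_real s"
  assumes u: "corner_seq P Q R S u" and ne: "q \<noteq> 0" "s \<noteq> 0"
  shows "u n = (\<Sum>j = 1..5. kappa_mu p q r s n j * mu P Q S j ^ n)"
proof -
  have NE: "Q \<noteq> 0" "S \<noteq> 0"
    using ne by (simp_all add: Q_def S_def)
  have eq1: "Q^2 = 4 * S * (P - 2 * S) \<longleftrightarrow> q^2 = 4 * s * (p - 2 * s)"
  proof -
    have "Q^2 = complex_of_real (q^2)" "4 * S * (P - 2 * S) = complex_of_real (4 * s * (p - 2 * s))"
      by (simp_all add: P_def Q_def S_def)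
    then show ?thesis by (simp only: of_real_eq_iff)
  qed
  have eq2: "Q^2 = (P + 2 * S)^2 / 4 \<longleftrightarrow> q^2 = (p + 2 * s)^2 / 4"
  proof -
    have "Q^2 = complex_of_real (q^2)" "(P + 2 * S)^2 / 4 = complex_of_real ((p + 2 * s)^2 / 4)"
      by (simp_all add: P_def Q_def S_def)
    then show ?thesis by (simp only: of_real_eq_iff)
  qed
  have eq3: "P = 6 * S \<longleftrightarrow> p = 6 * s"
  proof -
    have "6 * S = complex_of_real (6 * s)"
      by (simp add: S_def)
    then show ?thesis by (simp only: P_def of_real_eq_iff)
  qed
  note fold = P_def[symmetric] Q_def[symmetric] R_def[symmetric] S_def[symmetric]
  have five: "{1..5::nat} = {1, 2, 3, 4, 5}" by auto
  consider (generic) "q^2 \<notin> {4*s*(p - 2*s), (p + 2*s)^2 / 4}"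
    | (quintuple) "q^2 \<in> {4*s*(p - 2*s), (p + 2*s)^2 / 4}" "p = 6 * s"
    | (triple) "q^2 = 4*s*(p - 2*s)" "p \<noteq> 6 * s"
    | (double) "q^2 = (p + 2*s)^2 / 4" "q^2 \<noteq> 4*s*(p - 2*s)" "p \<noteq> 6 * s"
    by blast
  then show ?thesis
  proof cases
    case generic
    then have "kappa_mu p q r s n j = kappa_mu_generic P Q R S ! (j - 1)" for j
      by (simp add: kappa_mu_def fold)
    then show ?thesis
      using mu_closed_form_generic[OF u NE, of n] generic eq1 eq2 by simp
  next
    case quintuple
    then have "q^2 = 16 * s^2" "q^2 = (p + 2 * s)^2 / 4"
      by (auto simp: power2_eq_square)
    then have Q: "Q^2 = 16 * S^2" "Q^2 = (P + 2 * S)^2 / 4"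
      using eq2 by (simp_all add: Q_def S_def flip: of_real_power)
    have P: "P = 6 * S"
      using eq3 quintuple by simp
    have "del P S = 0"
      unfolding del_def P by simp
    then have mu: "mu P Q S 1 = S" "mu P Q S 2 = S" "mu P Q S 3 = S" "mu P Q S 4 = S" "mu P Q S 5 = S"
      unfolding mu_alpha_zero[OF Q(2)] by (simp_all add: P)
    have "kappa_mu p q r s n j = kappa_mu_4 R S n ! (j - 1)" for j
      using quintuple by (auto simp: kappa_mu_def fold)
    then show ?thesis
      unfolding five corner_seq_unique[OF u corner_seq_quintuple_root[OF NE(2) P Q(1)], of n]
      by (simp add: kappa_mu_4_def mu[unfolded One_nat_def] distrib_right)
  next
    case triple
    have closed: "u n = (K1 P R S + 2 * of_nat n * K2 P R S 2 + of_nat n ^ 2 * K2 P R S 1) * S ^ n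
     + K3 P R S (gam P S) * ((P - 4 * S - gam P S) / 2) ^ n
     + K3 P R S (- gam P S) * ((P - 4 * S + gam P S) / 2) ^ n"
      using mu_closed_form_triple_root[OF u NE] eq1 eq3 triple by blast
    show ?thesis
    proof (cases "p > 6 * s")
      case True
      then have "kappa_mu p q r s n j = kappa_mu_2_gt P R S n ! (j - 1)" for j
        using triple by (simp add: kappa_mu_def fold)
      then show ?thesis
        unfolding five closed
        by (simp add: kappa_mu_2_gt_def distrib_right
            mu_exceptional_large[OF triple(1) True, unfolded fold One_nat_def])
    next
      case False
      then have "p < 6 * s"
        using triple(2) by simp
      note mu = mu_exceptional_small[OF triple(1) this, unfolded fold One_nat_def]
      have "kappa_mu p q r s n j = kappa_mu_2_lt P R S n ! (j - 1)" for j
        using triple False by (simp add: kappa_mu_def fold)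
      then show ?thesis
        unfolding five closed by (simp add: kappa_mu_2_lt_def distrib_right mu)
    qed
  next
    case double
    then have Q: "Q^2 = (P + 2 * S)^2 / 4"
      using eq2 by simp
    have "kappa_mu p q r s n j = kappa_mu_3 P R S n ! (j - 1)" for j
      using double by (simp add: kappa_mu_def fold)
    moreover have "P \<noteq> 6 * S"
      using eq3 double by simp
    ultimately show ?thesis
      unfolding five mu_closed_form_two_double_roots[OF u NE \<open>P \<noteq> 6 * S\<close> Q, of n]
      by (simp add: kappa_mu_3_def distrib_right mu_alpha_zero[OF Q, unfolded One_nat_def])
  qed
qed

lemma nu_closed_form:
  fixes u :: "nat \<Rightarrow> complex"
  assumes u: "corner_seq p 0 r s u" and s: "s \<noteq> 0"
  shows "u n = (\<Sum>j = 1..4. kappa_nu p r s n j * nu p s j ^ n)"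
proof (cases "p^2 = 4 * s^2")
  case False
  then show ?thesis using nu_closed_form_generic[OF u s] by blast
next
  case True
  have four: "{1..4::nat} = {1, 2, 3, 4}" by auto
  have rt: "csqrt (p^2 - 4 * s^2) = 0"
    using True by simp
  have "(p - 2 * s) * (p + 2 * s) = 0"
    using True by (simp add: algebra_simps power2_eq_square)
  moreover have "2 * s \<noteq> 2 * (- s)"
    using s by simp
  ultimately consider "p = 2 * s" | "p = 2 * (- s)" "p \<noteq> 2 * s"
    by (metis add_eq_0_iff2 eq_iff_diff_eq_0 mult_eq_0_iff mult_minus_right)
  then show ?thesis
  proof cases
    case 1
    show ?thesis
      unfolding four corner_seq_unique[OF u corner_seq_nu_triple_root[of s p s], OF s 1 disjI1[OF refl], of n]
      using True 1 by (simp add: kappa_nu_def nu_def rt distrib_right)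
  next
    case 2
    show ?thesis
      unfolding four corner_seq_unique[OF u corner_seq_nu_triple_root[of "- s" p s], OF _ 2(1) disjI2[OF minus_minus[symmetric]], of n, unfolded neg_equal_0_iff_equal, OF s]
      using True 2 s by (simp add: kappa_nu_def nu_def rt) (simp add: field_simps)
  qed
qed

lemma xi_closed_form:
  fixes u :: "nat \<Rightarrow> complex"
  assumes u: "corner_seq p q r 0 u" and q: "q \<noteq> 0"
  shows "u n = (\<Sum>j = 1..2. kappa_xi p q r n j * xi p q j ^ n)"
proof (cases "p^2 = 4 * q^2")
  case False
  then show ?thesis using xi_closed_form_generic[OF u] by blast
next
  case True
  have two: "{1..2::nat} = {1, 2}" by auto
  have "p \<noteq> 0" "q^2 = p^2 / 4"
    using True q by auto
  note closed = corner_seq_unique[OF u corner_seq_xi_double_root[OF this], of n]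
  show ?thesis
    unfolding two closed
    using True by (simp add: kappa_xi_def xi_def distrib_right)
qed

section \<open>The determinant with both corners perturbed\<close>

lemma sum_coeff_atMost:
  fixes f :: "'a :: comm_ring_1 poly"
  assumes "degree f \<le> k"
  shows "(\<Sum>i\<le>degree f. coeff f i * v i) = (\<Sum>i\<le>k. coeff f i * v i)"
  using assms by (intro sum.mono_neutral_left) (auto simp: coeff_eq_0)

lemma sum_index_term:
  "(\<Sum>j\<in>J. index_term (k j) f (z j) m)
     = (\<Sum>i\<le>degree f. coeff f i * (\<Sum>j\<in>J. k j (m + i) * z j ^ (m + i)))"
  unfolding index_term_def by (subst sum.swap) (simp add: sum_distrib_left mult.assoc)

text \<open>
  If \<open>\<chi>\<close> is the characteristic polynomial of order \<open>k\<close>, then \<open>f\<close> is \<open>z ^ k + (r - p) * z ^ (k - 1) - \<chi>\<close>, and \<open>\<chi>\<close>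
  contributes nothing to the combination of consecutive terms of the sequence.
\<close>
lemma f_poly_combination:
  assumes u: "corner_seq p q r s u"
  shows "q \<noteq> 0 \<Longrightarrow> s \<noteq> 0 \<Longrightarrow>
      (\<Sum>i\<le>degree (f_poly p q r s). coeff (f_poly p q r s) i * u (m + i)) = u (m + 5) + (r - p) * u (m + 4)"
    and "q = 0 \<Longrightarrow> s \<noteq> 0 \<Longrightarrow>
      (\<Sum>i\<le>degree (f_poly p q r s). coeff (f_poly p q r s) i * u (m + i)) = u (m + 4) + (r - p) * u (m + 3)"
    and "s = 0 \<Longrightarrow>
      (\<Sum>i\<le>degree (f_poly p q r s). coeff (f_poly p q r s) i * u (m + i)) = u (m + 2) + (r - p) * u (m + 1)"
proof -
  have "degree (f_poly p q r s) \<le> 4"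
    by (intro degree_le) (auto simp: f_poly_def)
  note sum = sum_coeff_atMost[OF this]
  have four: "{..4::nat} = {0, 1, 2, 3, 4}"
    by auto
  show "(\<Sum>i\<le>degree (f_poly p q r s). coeff (f_poly p q r s) i * u (m + i)) = u (m + 5) + (r - p) * u (m + 4)"
    if "q \<noteq> 0" "s \<noteq> 0"
    unfolding sum using u that by (simp add: four f_poly_def corner_seq_def algebra_simps eval_nat_numeral)
  show "(\<Sum>i\<le>degree (f_poly p q r s). coeff (f_poly p q r s) i * u (m + i)) = u (m + 4) + (r - p) * u (m + 3)"
    if "q = 0" "s \<noteq> 0"
    unfolding sum using corner_seq_q0[of p r s u m] u that
    by (simp add: four f_poly_def algebra_simps)
  show "(\<Sum>i\<le>degree (f_poly p q r s). coeff (f_poly p q r s) i * u (m + i)) = u (m + 2) + (r - p) * u (m + 1)"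
    if "s = 0"
    unfolding sum using corner_seq_s0[of p q r u m] u that
    by (simp add: four f_poly_def algebra_simps)
qed

theorem theorem3p1:
  fixes p q r s :: real and n :: nat
  defines "P \<equiv> complex_of_real p" and "Q \<equiv> complex_of_real q"
    and "R \<equiv> complex_of_real r" and "S \<equiv> complex_of_real s"
  defines "f \<equiv> f_poly P Q R S"
  defines "detD \<equiv> complex_of_real (det (D_mat p q r s n))"
  shows
    "(q \<noteq> 0 \<and> s \<noteq> 0 \<and> n \<ge> 6 \<longrightarrow>
        (if q^2 \<notin> {4*s*(p - 2*s), (p + 2*s)^2 / 4}
         then detD = (\<Sum>j = 1..5. kappa_mu p q r s n j * poly f (mu P Q S j) * mu P Q S j ^ (n - 5))
         else detD = (\<Sum>j = 1..5. index_term (\<lambda>m. kappa_mu p q r s m j) f (mu P Q S j) (n - 5))))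
   \<and> (q = 0 \<and> s \<noteq> 0 \<and> n \<ge> 5 \<longrightarrow>
        (if p^2 \<noteq> 4*s^2
         then detD = (\<Sum>j = 1..4. kappa_nu P R S n j * poly f (nu P S j) * nu P S j ^ (n - 4))
         else detD = (\<Sum>j = 1..4. index_term (\<lambda>m. kappa_nu P R S m j) f (nu P S j) (n - 4))))
   \<and> (q \<noteq> 0 \<and> s = 0 \<and> n \<ge> 3 \<longrightarrow>
        (if p^2 \<noteq> 4*q^2
         then detD = (\<Sum>j = 1..2. kappa_xi P Q R n j * poly f (xi P Q j) * xi P Q j ^ (n - 2))
         else detD = (\<Sum>j = 1..2. index_term (\<lambda>m. kappa_xi P Q R m j) f (xi P Q j) (n - 2))))
   \<and> (q = 0 \<and> s = 0 \<and> n \<ge> 3 \<longrightarrow> det (D_mat p q r s n) = r^2 * p^(n - 2))"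
proof -
  define u where "u m = complex_of_real (lead_det p q r s m)" for m
  have u: "corner_seq P Q R S u"
    using corner_seq_of_real[OF corner_seq_lead_det[of p q r s]]
    unfolding P_def Q_def R_def S_def u_def .
  have detD: "detD = u n + (R - P) * u (n - 1)" if "n \<ge> 3"
    using det_D_mat[OF that, of p q r s] by (simp add: detD_def u_def R_def P_def)
  have Q0: "Q = 0 \<longleftrightarrow> q = 0" and S0: "S = 0 \<longleftrightarrow> s = 0"
    by (simp_all add: Q_def S_def)
  have index: "(\<Sum>j\<in>J. index_term (\<lambda>m. k m j) f (z j) m) = (\<Sum>i\<le>degree f. coeff f i * u (m + i))"
    if "\<And>m. u m = (\<Sum>j\<in>J. k m j * z j ^ m)" for J :: "nat set" and k z m
    unfolding sum_index_term that[symmetric] ..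
  have const: "(\<Sum>j\<in>J. k n j * poly f (z j) * z j ^ m) = (\<Sum>j\<in>J. index_term (\<lambda>m. k m j) f (z j) m)"
    if "\<And>m j. k m j = k n j" for J :: "nat set" and k z m
  proof -
    have "(\<lambda>m. k m j) = (\<lambda>_. k n j)" for j
      using that by blast
    then show ?thesis
      by (simp add: index_term_const)
  qed
  show ?thesis
  proof (intro conjI impI; (elim conjE)?)
    assume ne: "q \<noteq> 0" "s \<noteq> 0" and n: "n \<ge> 6"
    have D: "detD = (\<Sum>j = 1..5. index_term (\<lambda>m. kappa_mu p q r s m j) f (mu P Q S j) (n - 5))"
    proof -
      have "(\<Sum>j = 1..5. index_term (\<lambda>m. kappa_mu p q r s m j) f (mu P Q S j) (n - 5))
          = u (n - 5 + 5) + (R - P) * u (n - 5 + 4)"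
        using index[OF mu_closed_form[OF u[unfolded P_def Q_def R_def S_def] ne]]
          f_poly_combination(1)[OF u] ne Q0 S0 unfolding f_def P_def Q_def R_def S_def by simp
      moreover have "n - 5 + 5 = n" "n - 5 + 4 = n - 1"
        using n by auto
      ultimately show ?thesis
        using detD n by simp
    qed
    have "detD = (\<Sum>j = 1..5. kappa_mu p q r s n j * poly f (mu P Q S j) * mu P Q S j ^ (n - 5))"
      if "q^2 \<notin> {4*s*(p - 2*s), (p + 2*s)^2 / 4}"
    proof -
      have "kappa_mu p q r s m j = kappa_mu p q r s n j" for m j
        using that by (simp add: kappa_mu_def)
      then show ?thesis
        unfolding D by (rule const[symmetric])
    qed
    then show "if q^2 \<notin> {4*s*(p - 2*s), (p + 2*s)^2 / 4}
         then detD = (\<Sum>j = 1..5. kappa_mu p q r s n j * poly f (mu P Q S j) * mu P Q S j ^ (n - 5))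
         else detD = (\<Sum>j = 1..5. index_term (\<lambda>m. kappa_mu p q r s m j) f (mu P Q S j) (n - 5))"
      unfolding if_bool_eq_conj using D by blast
  next
    assume q: "q = 0" and s: "s \<noteq> 0" and n: "n \<ge> 5"
    have u0: "corner_seq P 0 R S u"
      using u q by (simp add: Q_def)
    have D: "detD = (\<Sum>j = 1..4. index_term (\<lambda>m. kappa_nu P R S m j) f (nu P S j) (n - 4))"
    proof -
      have "(\<Sum>j = 1..4. index_term (\<lambda>m. kappa_nu P R S m j) f (nu P S j) (n - 4))
          = u (n - 4 + 4) + (R - P) * u (n - 4 + 3)"
        using index[OF nu_closed_form[OF u0]] f_poly_combination(2)[OF u] q s Q0 S0
        unfolding f_def by simp
      moreover have "n - 4 + 4 = n" "n - 4 + 3 = n - 1"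
        using n by auto
      ultimately show ?thesis
        using detD n by simp
    qed
    have square: "P^2 = 4 * S^2 \<longleftrightarrow> p^2 = 4 * s^2"
    proof -
      have "P^2 = complex_of_real (p^2)" "4 * S^2 = complex_of_real (4 * s^2)"
        by (simp_all add: P_def S_def)
      then show ?thesis by (simp only: of_real_eq_iff)
    qed
    have "detD = (\<Sum>j = 1..4. kappa_nu P R S n j * poly f (nu P S j) * nu P S j ^ (n - 4))"
      if "p^2 \<noteq> 4*s^2"
    proof -
      have "kappa_nu P R S m j = kappa_nu P R S n j" for m j
        using that square by (simp add: kappa_nu_def)
      then show ?thesis
        unfolding D by (rule const[symmetric])
    qed
    then show "if p^2 \<noteq> 4*s^2
         then detD = (\<Sum>j = 1..4. kappa_nu P R S n j * poly f (nu P S j) * nu P S j ^ (n - 4))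
         else detD = (\<Sum>j = 1..4. index_term (\<lambda>m. kappa_nu P R S m j) f (nu P S j) (n - 4))"
      unfolding if_bool_eq_conj using D by blast
  next
    assume q: "q \<noteq> 0" and s: "s = 0" and n: "n \<ge> 3"
    have u0: "corner_seq P Q R 0 u"
      using u s by (simp add: S_def)
    have D: "detD = (\<Sum>j = 1..2. index_term (\<lambda>m. kappa_xi P Q R m j) f (xi P Q j) (n - 2))"
    proof -
      have "(\<Sum>j = 1..2. index_term (\<lambda>m. kappa_xi P Q R m j) f (xi P Q j) (n - 2))
          = u (n - 2 + 2) + (R - P) * u (n - 2 + 1)"
        using index[OF xi_closed_form[OF u0]] f_poly_combination(3)[OF u] q s Q0 S0
        unfolding f_def by simp
      moreover have "n - 2 + 2 = n" "n - 2 + 1 = n - 1"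
        using n by auto
      ultimately show ?thesis
        using detD n by simp
    qed
    have square: "P^2 = 4 * Q^2 \<longleftrightarrow> p^2 = 4 * q^2"
    proof -
      have "P^2 = complex_of_real (p^2)" "4 * Q^2 = complex_of_real (4 * q^2)"
        by (simp_all add: P_def Q_def)
      then show ?thesis by (simp only: of_real_eq_iff)
    qed
    have "detD = (\<Sum>j = 1..2. kappa_xi P Q R n j * poly f (xi P Q j) * xi P Q j ^ (n - 2))"
      if "p^2 \<noteq> 4*q^2"
    proof -
      have "kappa_xi P Q R m j = kappa_xi P Q R n j" for m j
        using that square by (simp add: kappa_xi_def)
      then show ?thesis
        unfolding D by (rule const[symmetric])
    qed
    then show "if p^2 \<noteq> 4*q^2
         then detD = (\<Sum>j = 1..2. kappa_xi P Q R n j * poly f (xi P Q j) * xi P Q j ^ (n - 2))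
         else detD = (\<Sum>j = 1..2. index_term (\<lambda>m. kappa_xi P Q R m j) f (xi P Q j) (n - 2))"
      unfolding if_bool_eq_conj using D by blast
  next
    assume q: "q = 0" and s: "s = 0" and n: "n \<ge> 3"
    have e: "lead_det p q r s (Suc m) = r * p ^ m" for m
    proof (induction m)
      case 0
      then show ?case by (simp add: lead_det_1)
    next
      case (Suc m)
      then show ?case
        using corner_seq_s0[of p q r "lead_det p q r s" m] corner_seq_lead_det[of p q r s] q s
        by simp
    qed
    obtain m where m: "n = m + 3"
      using n by (metis add.commute le_Suc_ex)
    show "det (D_mat p q r s n) = r^2 * p^(n - 2)"
      using det_D_mat[OF n, of p q r s] e[of "m + 1"] e[of "m + 2"]
      by (simp add: m eval_nat_numeral algebra_simps)
  qed
qed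

end
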